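(* Let $f:\Omega\to\mathbb{R}$ be measurable with $\int_\Omega |f(x)|\pi(x)\,dx<\infty$ and put $\mu=\int_\Omega f(x)\pi(x)\,dx$. Let $x^{(i)}_m$ ($i\ge 1$, $1\le m\le M$) be the samples produced by the MP-MCMC algorithm described in the context. Assume that the sequence $Z_i=(x^{(i)}_1,\dots,x^{(i)}_M)$, $i\ge1$, of accepted samples per iteration is a positive Harris Markov chain on $\Omega^M$. Then the law of large numbers holds: $$\hat\mu_{n,M,N}:=\frac{1}{nM}\sum_{i=1}^n\sum_{m=1}^M f\big(x^{(i)}_m\big)\longrightarrow \mu\quad\text{almost surely as } n\to\infty .$$
   Context: Let $d,N,M\in\mathbb{N}$, $\Omega\subset\mathbb{R}^d$, and let $\pi$ be a probability density (the target) on $\Omega$. For $y_{1:N+1}=(y_1,\dots,y_{N+1})\in\Omega^{N+1}$ write $y_{\setminus i}=(y_1,\dots,y_{i-1},y_{i+1},\dots,y_{N+1})$. A proposal kernel $\kappa$ assigns to each $y\in\Omega$ a probability density $\kappa(y,\cdot)$ on $\Omega^N$. MP-MCMC algorithm (multiple-proposal Metropolis-Hastings): start with $y_1\in\Omega$ and index $I=1$. In each iteration: (1) keep $y_I$ and draw $y_{\setminus I}\sim\kappa(y_I,\cdot)$; (2) compute, for $i=1,\dots,N+1$, $$p(I=i\mid y_{1:N+1})=\frac{\pi(y_i)\kappa(y_i,y_{\setminus i})}{\sum_{j=1}^{N+1}\pi(y_j)\kappa(y_j,y_{\setminus j})};$$ (3) draw $I_1,\dots,I_M$ independently from $p(\cdot\mid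 y_{1:N+1})$ and output the samples $x_m=y_{I_m}$, $m=1,\dots,M$; (4) set $I=I_M$ and continue with the next iteration. The $m$-th sample of iteration $i$ is denoted $x_m^{(i)}$. The updates preserve the joint density $p(y_{1:N+1},I=i)=\frac1{N+1}\pi(y_i)\kappa(y_i,y_{\setminus i})$ on $\Omega^{N+1}\times\{1,\dots,N+1\}$. The vectors $(x^{(i)}_1,\dots,x^{(i)}_M)$ of accepted samples are regarded as a time-homogeneous Markov chain on $\Omega^M$ whose transition probabilities depend on the current state only through its last coordinate $x^{(i)}_M$. "Positive Harris" means Harris recurrent with an invariant probability distribution (Meyn and Tweedie). *)

theory Defs
  imports "HOL-Probability.Probability"
begin

section \<open>Markov chains on a general state space\<close>

text \<open>Law on \<open>S\<^sup>\<nat>\<close> of the time-homogeneous Markov chain with initial distribution \<open>\<nu>\<close> and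
  transition kernel \<open>K\<close>, obtained from the Ionescu-Tulcea theorem of the library.  It is meaningful
  only when \<open>\<nu>\<close> is a probability measure on \<open>S\<close> and \<open>K\<close> is a probability kernel on \<open>S\<close>.\<close>

definition chain_law :: "'s measure \<Rightarrow> 's measure \<Rightarrow> ('s \<Rightarrow> 's measure) \<Rightarrow> (nat \<Rightarrow> 's) measure" where
  "chain_law S \<nu> K =
     projective_family.lim UNIV
       (Ionescu_Tulcea.CI (\<lambda>i \<omega>. if i = 0 then \<nu> else K (\<omega> (i - 1))) (\<lambda>_. S)) (\<lambda>_. S)"

definition markov_chain ::
    "'w measure \<Rightarrow> 's measure \<Rightarrow> 's measure \<Rightarrow> ('s \<Rightarrow> 's measure) \<Rightarrow> (nat \<Rightarrow> 'w \<Rightarrow> 's) \<Rightarrow> bool" where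
  "markov_chain P S \<nu> K X \<longleftrightarrow>
     prob_space P \<and> (\<forall>i. X i \<in> P \<rightarrow>\<^sub>M S) \<and>
     distr P (Pi\<^sub>M UNIV (\<lambda>_. S)) (\<lambda>\<omega> i. X i \<omega>) = chain_law S \<nu> K"

text \<open>The definitions up to \<open>positive_harris\<close> follow Meyn and Tweedie.  The return time to \<open>A\<close> only
  counts visits at times \<open>n \<ge> 1\<close>.\<close>

definition irreducibility_measure :: "'s measure \<Rightarrow> ('s \<Rightarrow> 's measure) \<Rightarrow> 's measure \<Rightarrow> bool" where
  "irreducibility_measure S K \<phi> \<longleftrightarrow>
     sets \<phi> = sets S \<and> emeasure \<phi> (space S) > 0 \<and>
     (\<forall>A\<in>sets S. emeasure \<phi> A > 0 \<longrightarrow>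
        (\<forall>x\<in>space S. emeasure (chain_law S (return S x) K)
           {\<omega> \<in> space (Pi\<^sub>M UNIV (\<lambda>_. S)). \<exists>n\<ge>1. \<omega> n \<in> A} > 0))"

definition maximal_irreducibility_measure ::
    "'s measure \<Rightarrow> ('s \<Rightarrow> 's measure) \<Rightarrow> 's measure \<Rightarrow> bool" where
  "maximal_irreducibility_measure S K \<psi> \<longleftrightarrow>
     irreducibility_measure S K \<psi> \<and>
     (\<forall>\<phi>. irreducibility_measure S K \<phi> \<longrightarrow> absolutely_continuous \<psi> \<phi>)"

definition harris_recurrent :: "'s measure \<Rightarrow> ('s \<Rightarrow> 's measure) \<Rightarrow> bool" where
  "harris_recurrent S K \<longleftrightarrow>
     (\<exists>\<psi>. maximal_irreducibility_measure S K \<psi> \<and>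
        (\<forall>A\<in>sets S. emeasure \<psi> A > 0 \<longrightarrow>
           (\<forall>x\<in>A. AE \<omega> in chain_law S (return S x) K. infinite {n. \<omega> n \<in> A})))"

definition invariant_probability :: "'s measure \<Rightarrow> ('s \<Rightarrow> 's measure) \<Rightarrow> 's measure \<Rightarrow> bool" where
  "invariant_probability S K \<nu> \<longleftrightarrow>
     prob_space \<nu> \<and> sets \<nu> = sets S \<and>
     (\<forall>A\<in>sets S. (\<integral>\<^sup>+x. emeasure (K x) A \<partial>\<nu>) = emeasure \<nu> A)"

definition positive_harris :: "'s measure \<Rightarrow> ('s \<Rightarrow> 's measure) \<Rightarrow> bool" where
  "positive_harris S K \<longleftrightarrow>
     K \<in> S \<rightarrow>\<^sub>M prob_algebra S \<and> harris_recurrent S K \<and> (\<exists>\<nu>. invariant_probability S K \<nu>)"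

section \<open>Multiple-proposal Metropolis-Hastings\<close>

text \<open>\<open>\<Omega>\<^sup>n\<close> with its Lebesgue measure; a point is a function on \<open>{1..n}\<close>, extended by
  \<^const>\<open>undefined\<close>.\<close>

definition points :: "'a::euclidean_space set \<Rightarrow> nat \<Rightarrow> (nat \<Rightarrow> 'a) measure" where
  "points \<Omega> n = Pi\<^sub>M {1..n} (\<lambda>_. restrict_space lborel \<Omega>)"

definition is_target :: "'a::euclidean_space set \<Rightarrow> ('a \<Rightarrow> real) \<Rightarrow> bool" where
  "is_target \<Omega> \<pi> \<longleftrightarrow>
     \<pi> \<in> borel_measurable (restrict_space lborel \<Omega>) \<and> (\<forall>x\<in>\<Omega>. 0 \<le> \<pi> x) \<and>
     (\<integral>\<^sup>+x. ennreal (\<pi> x) \<partial>restrict_space lborel \<Omega>) = 1"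

definition is_proposal_kernel ::
    "'a::euclidean_space set \<Rightarrow> nat \<Rightarrow> ('a \<Rightarrow> (nat \<Rightarrow> 'a) \<Rightarrow> real) \<Rightarrow> bool" where
  "is_proposal_kernel \<Omega> N \<kappa> \<longleftrightarrow>
     (\<lambda>(x, z). \<kappa> x z) \<in> borel_measurable (restrict_space lborel \<Omega> \<Otimes>\<^sub>M points \<Omega> N) \<and>
     (\<forall>x\<in>\<Omega>. (\<forall>z\<in>space (points \<Omega> N). 0 \<le> \<kappa> x z) \<and>
        (\<integral>\<^sup>+z. ennreal (\<kappa> x z) \<partial>points \<Omega> N) = 1)"

text \<open>\<open>omit N i y\<close> is \<open>y\<close> without its \<open>i\<close>-th entry; \<open>put N i x z\<close> is the vector \<open>y\<close> with
  \<open>y i = x\<close> and \<open>omit N i y = z\<close>.\<close>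

definition omit :: "nat \<Rightarrow> nat \<Rightarrow> (nat \<Rightarrow> 'a) \<Rightarrow> nat \<Rightarrow> 'a" where
  "omit N i y = (\<lambda>j\<in>{1..N}. if j < i then y j else y (j + 1))"

definition put :: "nat \<Rightarrow> nat \<Rightarrow> 'a \<Rightarrow> (nat \<Rightarrow> 'a) \<Rightarrow> nat \<Rightarrow> 'a" where
  "put N i x z = (\<lambda>j\<in>{1..N+1}. if j < i then z j else if j = i then x else z (j - 1))"

text \<open>\<open>p y i\<close> stands for \<open>p(I = i | y)\<close>.  The defining quotient is \<open>0/0\<close> where the denominator
  vanishes; there \<open>p y\<close> may be any probability vector depending measurably on \<open>y\<close>.\<close>

definition is_selection_probability ::
    "'a::euclidean_space set \<Rightarrow> ('a \<Rightarrow> real) \<Rightarrow> ('a \<Rightarrow> (nat \<Rightarrow> 'a) \<Rightarrow> real) \<Rightarrow> nat \<Rightarrow>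
     ((nat \<Rightarrow> 'a) \<Rightarrow> nat \<Rightarrow> real) \<Rightarrow> bool" where
  "is_selection_probability \<Omega> \<pi> \<kappa> N p \<longleftrightarrow>
     (\<forall>i\<in>{1..N+1}. (\<lambda>y. p y i) \<in> borel_measurable (points \<Omega> (N+1))) \<and>
     (\<forall>y\<in>space (points \<Omega> (N+1)).
        (\<forall>i\<in>{1..N+1}. 0 \<le> p y i) \<and> (\<Sum>i=1..N+1. p y i) = 1 \<and>
        ((\<Sum>j=1..N+1. \<pi> (y j) * \<kappa> (y j) (omit N j y)) \<noteq> 0 \<longrightarrow>
           (\<forall>i\<in>{1..N+1}. p y i =
              \<pi> (y i) * \<kappa> (y i) (omit N i y) / (\<Sum>j=1..N+1. \<pi> (y j) * \<kappa> (y j) (omit N j y)))))"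

text \<open>The outcome of an iteration is the pair of \<open>y\<^bsub>1:N+1\<^esub>\<close> and \<open>(I\<^sub>1, \<dots>, I\<^sub>M)\<close>.\<close>

definition outcomes ::
    "'a::euclidean_space set \<Rightarrow> nat \<Rightarrow> nat \<Rightarrow> ((nat \<Rightarrow> 'a) \<times> (nat \<Rightarrow> nat)) measure" where
  "outcomes \<Omega> N M = points \<Omega> (N+1) \<Otimes>\<^sub>M Pi\<^sub>M {1..M} (\<lambda>_. count_space {1..N+1})"

text \<open>Law of the outcome of an iteration that keeps the point \<open>x\<close> at index \<open>J\<close>: the proposals \<open>z\<close>
  have density \<open>\<kappa> x\<close> and, given \<open>y = put N J x z\<close>, the indices are i.i.d. with distribution
  \<open>p y\<close>.  The joint density is taken with respect to Lebesgue times counting measure.\<close>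

definition iteration ::
    "'a::euclidean_space set \<Rightarrow> ('a \<Rightarrow> (nat \<Rightarrow> 'a) \<Rightarrow> real) \<Rightarrow> ((nat \<Rightarrow> 'a) \<Rightarrow> nat \<Rightarrow> real) \<Rightarrow> nat \<Rightarrow> nat \<Rightarrow>
     'a \<Rightarrow> nat \<Rightarrow> ((nat \<Rightarrow> 'a) \<times> (nat \<Rightarrow> nat)) measure" where
  "iteration \<Omega> \<kappa> p N M x J =
     distr
       (density (points \<Omega> N \<Otimes>\<^sub>M Pi\<^sub>M {1..M} (\<lambda>_. count_space {1..N+1}))
          (\<lambda>(z, I). ennreal (\<kappa> x z * (\<Prod>m=1..M. p (put N J x z) (I m)))))
       (outcomes \<Omega> N M) (\<lambda>(z, I). (put N J x z, I))"

text \<open>\<open>Y i\<close> and \<open>I i\<close> are the points and the sampled indices of iteration \<open>i \<ge> 1\<close>; the values at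
  \<open>i = 0\<close> are irrelevant.  The first iteration keeps \<open>y\<^sub>1\<close> at index \<open>1\<close>.\<close>

definition mp_mcmc ::
    "'w measure \<Rightarrow> 'a::euclidean_space set \<Rightarrow> ('a \<Rightarrow> (nat \<Rightarrow> 'a) \<Rightarrow> real) \<Rightarrow>
     ((nat \<Rightarrow> 'a) \<Rightarrow> nat \<Rightarrow> real) \<Rightarrow> nat \<Rightarrow> nat \<Rightarrow> 'a \<Rightarrow>
     (nat \<Rightarrow> 'w \<Rightarrow> nat \<Rightarrow> 'a) \<Rightarrow> (nat \<Rightarrow> 'w \<Rightarrow> nat \<Rightarrow> nat) \<Rightarrow> bool" where
  "mp_mcmc P \<Omega> \<kappa> p N M y\<^sub>1 Y I \<longleftrightarrow>
     markov_chain P (outcomes \<Omega> N M) (iteration \<Omega> \<kappa> p N M y\<^sub>1 1)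
       (\<lambda>(y, J). iteration \<Omega> \<kappa> p N M (y (J M)) (J M))
       (\<lambda>i \<omega>. (Y (i + 1) \<omega>, I (i + 1) \<omega>))"

definition accepted :: "nat \<Rightarrow> (nat \<Rightarrow> 'a) \<times> (nat \<Rightarrow> nat) \<Rightarrow> nat \<Rightarrow> 'a" where
  "accepted M = (\<lambda>(y, I). \<lambda>m\<in>{1..M}. y (I m))"

text \<open>\<open>K\<close> is the transition kernel on \<open>\<Omega>\<^sup>M\<close> of the accepted samples: whatever the index \<open>J\<close> at
  which the last accepted sample \<open>z M\<close> is kept, the next vector of accepted samples has law \<open>K z\<close>.
  An ordering-dependent \<open>\<kappa>\<close> can make that law depend on \<open>J\<close>, and then the accepted samples alone
  do not form a Markov chain of this kind.\<close>

definition accepted_samples_kernel ::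
    "'a::euclidean_space set \<Rightarrow> ('a \<Rightarrow> (nat \<Rightarrow> 'a) \<Rightarrow> real) \<Rightarrow> ((nat \<Rightarrow> 'a) \<Rightarrow> nat \<Rightarrow> real) \<Rightarrow> nat \<Rightarrow> nat \<Rightarrow>
     ((nat \<Rightarrow> 'a) \<Rightarrow> (nat \<Rightarrow> 'a) measure) \<Rightarrow> bool" where
  "accepted_samples_kernel \<Omega> \<kappa> p N M K \<longleftrightarrow>
     (\<forall>z\<in>space (points \<Omega> M). \<forall>J\<in>{1..N+1}.
        distr (iteration \<Omega> \<kappa> p N M (z M) J) (points \<Omega> M) (accepted M) = K z)"

end

theory Submission
  imports Defs
begin

text \<open>Let \<open>\<rho>\<close> be the law of the accepted samples of an iteration that keeps a point drawn from the
  target.  Since the iteration preserves the joint density of points and index, every coordinate of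
  \<open>\<rho>\<close> has the target law; as the chain only remembers its last coordinate, \<open>\<rho>\<close> is invariant.  So it
  suffices to prove the law of large numbers for a Harris chain with invariant law \<open>\<rho>\<close>.

  For a Harris chain every shift-invariant event \<open>A\<close> has the same probability, \<open>0\<close> or \<open>1\<close>, from all
  starting points: if \<open>A\<close> has probability at most \<open>c < 1\<close> from each point of a set that is visited
  infinitely often, then restarting the chain at the first visit after time \<open>n\<close> gives
  \<open>P (A \<inter> D) \<le> c * P D\<close> for all events \<open>D\<close> up to time \<open>n\<close>, and approximating \<open>A\<close> by such \<open>D\<close> gives
  \<open>P A \<le> c * P A\<close>.  Apply this to the event that the partial sums of \<open>g - b\<close> are unbounded above,
  which is exactly shift-invariant.  If it had probability \<open>1\<close>, the maximal ergodic theorem for the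
  stationary chain would give \<open>b \<le> \<integral> g d\<rho>\<close>.  Hence for \<open>b > \<integral> g d\<rho>\<close> the partial sums are almost
  surely at most \<open>c + n * b\<close>, from every starting point; the same for \<open>- g\<close> yields the limit.\<close>

section \<open>Finite-dimensional distributions and the Markov property\<close>

text \<open>Preservation of the joint density is an identity for the sum over all
  \<open>N + 1\<close> positions \<open>J\<close> of the kept point, not for a single
  \<open>J\<close>. \<open>accepted_samples_kernel\<close> makes the summands equal, so each of them
  satisfies the identity alone; this is how a fact about points and indices becomes one about
  accepted samples. The accepted samples are treated as an image of the chain of outcomes, which is
  the process that \<open>mp_mcmc\<close> describes.

  Two gaps shape the Harris part. The definition gives infinitely many visits to a set of positive
  irreducibility measure only from starting points inside that set; passing to all starting points
  takes a separate argument, in which the event of infinitely many visits is itself the invariant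
  event. Moreover, the mean of \<open>g\<close> is controlled by the stationary law, while the
  process starts from a law that may be singular to it; the zero-one law bridges the two because it
  leaves no dependence on the start. Restarting uses the Markov property at deterministic times
  only, the first visit time being split into its countably many values.\<close>

lemma prod_lessThan_add: "(\<Prod>i<k + n. f i) = (\<Prod>i<k. f i) * (\<Prod>j<n. f (k + j))"
  for f :: "nat \<Rightarrow> 'b::comm_monoid_mult"
  by (induction n) (simp_all add: mult.assoc)

text \<open>Constant factors \<open>1\<close> outside \<open>J\<close> pad a cylinder over an
  arbitrary finite index set to a product over an initial segment. The length has the form
  \<open>k + n\<close> so that the product can later be split at time \<open>k\<close>.\<close>

lemma indicator_prod_emb_eq_prod:
  fixes k :: nat and S :: "'s measure" and E :: "nat \<Rightarrow> 's set"
  assumes J: "finite J" and E: "\<And>i. i \<in> J \<Longrightarrow> E i \<in> sets S"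
  obtains n u where "\<And>i. u i \<in> borel_measurable S"
    and "\<And>\<omega>. \<omega> \<in> space (Pi\<^sub>M UNIV (\<lambda>_. S)) \<Longrightarrow>
      indicator (prod_emb (UNIV :: nat set) (\<lambda>_. S) J (Pi\<^sub>E J E)) \<omega> = (\<Prod>i<k + n. u i (\<omega> i) :: ennreal)"
proof -
  obtain n where "J \<subseteq> {..<n}"
    using J finite_nat_iff_bounded by blast
  then have n: "J \<subseteq> {..<k + n}"
    by auto
  define u where "u i = (if i \<in> J then indicator (E i) else (\<lambda>_. 1 :: ennreal))" for i
  show thesis
  proof
    show "u i \<in> borel_measurable S" for i
      using E by (auto simp: u_def)
    fix \<omega> :: "nat \<Rightarrow> 's" assume \<omega>: "\<omega> \<in> space (Pi\<^sub>M UNIV (\<lambda>_. S))"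
    have "(\<Prod>i<k + n. u i (\<omega> i)) = (\<Prod>i\<in>J. u i (\<omega> i))"
      using n by (intro prod.mono_neutral_right) (auto simp: u_def)
    also have "\<dots> = (\<Prod>i\<in>J. indicator (E i) (\<omega> i))"
      by (intro prod.cong) (auto simp: u_def)
    also have "\<dots> = (if \<forall>i\<in>J. \<omega> i \<in> E i then 1 else 0)"
      using J by (auto simp: indicator_def)
    also have "\<dots> = indicator (prod_emb (UNIV :: nat set) (\<lambda>_. S) J (Pi\<^sub>E J E)) \<omega>"
      using \<omega> by (auto simp: prod_emb_def space_PiM PiE_iff indicator_def)
    finally show "indicator (prod_emb (UNIV :: nat set) (\<lambda>_. S) J (Pi\<^sub>E J E)) \<omega> = (\<Prod>i<k + n. u i (\<omega> i))" ..
  qed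
qed

text \<open>Cylinders generate the path space, and by padding it is enough to compare products of
  length at least \<open>k\<close>. The parameter \<open>k\<close> serves the proof of the restart
  identity at time \<open>k\<close>.\<close>

lemma measure_eqI_cylinders:
  fixes k :: nat and Q R :: "(nat \<Rightarrow> 's) measure"
  assumes "prob_space Q" and [simp]: "sets Q = sets (Pi\<^sub>M UNIV (\<lambda>_. S))" "sets R = sets (Pi\<^sub>M UNIV (\<lambda>_. S))"
    and eq: "\<And>n u. (\<And>i. u i \<in> borel_measurable S) \<Longrightarrow>
      (\<integral>\<^sup>+\<omega>. (\<Prod>i<k + n. u i (\<omega> i)) \<partial>Q) = (\<integral>\<^sup>+\<omega>. (\<Prod>i<k + n. u i (\<omega> i)) \<partial>R)"
  shows "Q = R"
proof (rule measure_eqI_PiM_infinite[OF assms(2,3)])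
  interpret Q: prob_space Q by fact
  show "finite_measure Q" by (rule Q.finite_measure_axioms)
  fix A :: "nat \<Rightarrow> 's set" and J :: "nat set" assume "finite J" "\<And>i. i \<in> J \<Longrightarrow> A i \<in> sets S"
  note J = this
  let ?X = "prod_emb (UNIV :: nat set) (\<lambda>_. S) J (Pi\<^sub>E J A)"
  obtain n u where u: "\<And>i. u i \<in> borel_measurable S"
    "\<And>\<omega>. \<omega> \<in> space (Pi\<^sub>M UNIV (\<lambda>_. S)) \<Longrightarrow> indicator ?X \<omega> = (\<Prod>i<k + n. u i (\<omega> i) :: ennreal)"
  proof (rule indicator_prod_emb_eq_prod[OF J, where k=k])
    fix n u assume "\<And>i. u i \<in> borel_measurable S"
      "\<And>\<omega>. \<omega> \<in> space (Pi\<^sub>M UNIV (\<lambda>_. S)) \<Longrightarrow> indicator ?X \<omega> = (\<Prod>i<k + n. u i (\<omega> i) :: ennreal)"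
    then show thesis
      by (rule that)
  qed
  have [simp]: "?X \<in> sets (Pi\<^sub>M UNIV (\<lambda>_. S))"
    using J by (intro sets_PiM_I) auto
  have sp: "space Q = space (Pi\<^sub>M UNIV (\<lambda>_. S))" "space R = space (Pi\<^sub>M UNIV (\<lambda>_. S))"
    by (auto intro!: sets_eq_imp_space_eq)
  have "emeasure Q ?X = (\<integral>\<^sup>+\<omega>. indicator ?X \<omega> \<partial>Q)"
    by simp
  also have "\<dots> = (\<integral>\<^sup>+\<omega>. (\<Prod>i<k + n. u i (\<omega> i)) \<partial>Q)"
    by (intro nn_integral_cong) (simp add: u sp)
  also have "\<dots> = (\<integral>\<^sup>+\<omega>. (\<Prod>i<k + n. u i (\<omega> i)) \<partial>R)"
    by (intro eq u)
  also have "\<dots> = (\<integral>\<^sup>+\<omega>. indicator ?X \<omega> \<partial>R)"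
    by (intro nn_integral_cong) (simp add: u sp)
  finally show "emeasure Q ?X = emeasure R ?X"
    by simp
qed

section \<open>Path laws as iterated kernel integrals\<close>

locale markov_kernel =
  fixes S :: "'s measure" and K :: "'s \<Rightarrow> 's measure"
  assumes kernel: "K \<in> S \<rightarrow>\<^sub>M prob_algebra S"
begin

lemma kernel_subprob [measurable]: "K \<in> S \<rightarrow>\<^sub>M subprob_algebra S"
  using kernel by (rule measurable_prob_algebraD)

lemma kernel_in_prob_algebra: "x \<in> space S \<Longrightarrow> K x \<in> space (prob_algebra S)"
  using kernel by (rule measurable_space)

lemma prob_space_kernel: "x \<in> space S \<Longrightarrow> prob_space (K x)"
  using kernel_in_prob_algebra by (auto simp: space_prob_algebra)

lemma sets_kernel [simp, measurable_cong]: "x \<in> space S \<Longrightarrow> sets (K x) = sets S"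
  using kernel_in_prob_algebra by (auto simp: space_prob_algebra)

lemma space_kernel: "x \<in> space S \<Longrightarrow> space (K x) = space S"
  by (rule sets_eq_imp_space_eq) simp

lemma emeasure_kernel_space [simp]: "x \<in> space S \<Longrightarrow> emeasure (K x) (space S) = 1"
  using prob_space.emeasure_space_1[OF prob_space_kernel] by (simp add: space_kernel)

abbreviation paths :: "(nat \<Rightarrow> 's) measure" where "paths \<equiv> Pi\<^sub>M UNIV (\<lambda>_. S)"

text \<open>The expectation, for the chain started at \<open>x\<close>, of the product of
  \<open>u i\<close> evaluated at the position at time \<open>i\<close>, over \<open>i < n\<close>.
  The recursion peels off the first transition, which suits the Markov property.\<close>

primrec cyl_int :: "nat \<Rightarrow> (nat \<Rightarrow> 's \<Rightarrow> ennreal) \<Rightarrow> 's \<Rightarrow> ennreal" where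
  "cyl_int 0 u x = 1"
| "cyl_int (Suc n) u x = u 0 x * (\<integral>\<^sup>+y. cyl_int n (\<lambda>i. u (Suc i)) y \<partial>K x)"

lemma measurable_cyl_int [measurable (raw)]:
  assumes "\<And>i. u i \<in> borel_measurable S"
  shows "cyl_int n u \<in> borel_measurable S"
  using assms
proof (induction n arbitrary: u)
  case 0
  have "cyl_int 0 u = (\<lambda>_. 1)"
    by auto
  then show ?case
    by simp
next
  case (Suc n)
  note [measurable] = Suc.prems Suc.IH[of "\<lambda>i. u (Suc i)"]
  have "cyl_int (Suc n) u = (\<lambda>x. u 0 x * (\<integral>\<^sup>+y. cyl_int n (\<lambda>i. u (Suc i)) y \<partial>K x))"
    by auto
  then show ?case
    by simp
qed

text \<open>Integrating out the last coordinate turns it into an extra factor of the coordinate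
  before it. This reverses the direction of recursion: the Ionescu-Tulcea construction appends
  coordinates at the end, while \<open>cyl_int\<close> unfolds at the front.\<close>

lemma cyl_int_Suc_last:
  "cyl_int (Suc (Suc n)) u x =
    cyl_int (Suc n) (\<lambda>i. if i = n then (\<lambda>x. u n x * (\<integral>\<^sup>+y. u (Suc n) y \<partial>K x)) else u i) x"
  if "x \<in> space S"
  using that
proof (induction n arbitrary: u x)
  case 0
  then have "(\<integral>\<^sup>+y. u (Suc 0) y * (\<integral>\<^sup>+z. 1 \<partial>K y) \<partial>K x) = (\<integral>\<^sup>+y. u (Suc 0) y \<partial>K x)"
    by (intro nn_integral_cong) (simp add: space_kernel)
  with 0 show ?case
    by (simp add: space_kernel)
next
  case (Suc n)
  have *: "(\<integral>\<^sup>+y. cyl_int (Suc (Suc n)) (\<lambda>i. u (Suc i)) y \<partial>K x) =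
    (\<integral>\<^sup>+y. cyl_int (Suc n) (\<lambda>i. if i = n then (\<lambda>x. u (Suc n) x * (\<integral>\<^sup>+y. u (Suc (Suc n)) y \<partial>K x)) else u (Suc i)) y \<partial>K x)"
    using Suc.prems by (intro nn_integral_cong Suc.IH) (simp add: space_kernel)
  show ?case
    unfolding cyl_int.simps(2)[of "Suc (Suc n)"] cyl_int.simps(2)[of "Suc n"] *[unfolded cyl_int.simps(2)[of "Suc n"]]
    by (simp del: cyl_int.simps cong: if_cong)
qed

text \<open>The Markov property in terms of integrals: everything from time \<open>k\<close> on
  collapses into one function of the position at time \<open>k\<close>. That position is itself a
  coordinate, hence \<open>Suc k\<close> factors on the right.\<close>

lemma cyl_int_add:
  "x \<in> space S \<Longrightarrow> cyl_int (k + n) u x = cyl_int (Suc k) (\<lambda>i. if i < k then u i else cyl_int n (\<lambda>j. u (k + j))) x"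
proof (induction k arbitrary: u x)
  case 0
  then show ?case
    by (simp add: space_kernel)
next
  case (Suc k)
  have "(\<integral>\<^sup>+y. cyl_int (k + n) (\<lambda>i. u (Suc i)) y \<partial>K x) =
     (\<integral>\<^sup>+y. cyl_int (Suc k) (\<lambda>i. if i < k then u (Suc i) else cyl_int n (\<lambda>j. u (Suc (k + j)))) y \<partial>K x)"
    using Suc.prems by (intro nn_integral_cong Suc.IH) (simp add: space_kernel)
  then have "u 0 x * (\<integral>\<^sup>+y. cyl_int (k + n) (\<lambda>i. u (Suc i)) y \<partial>K x) =
     cyl_int (Suc (Suc k)) (\<lambda>i. if i < Suc k then u i else cyl_int n (\<lambda>j. u (Suc k + j))) x"
    by (subst cyl_int.simps(2)) (simp only: add_Suc Suc_less_eq zero_less_Suc if_True cong: if_cong)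
  then show ?case
    by simp
qed

context
  fixes \<nu> :: "'s measure"
  assumes init: "\<nu> \<in> space (prob_algebra S)"
begin

lemma Ionescu_Tulcea: "Ionescu_Tulcea (\<lambda>i \<omega>. if i = 0 then \<nu> else K (\<omega> (i - 1))) (\<lambda>_. S)"
proof (rule Ionescu_Tulcea.intro)
  show "(\<lambda>\<omega>. if i = 0 then \<nu> else K (\<omega> (i - 1))) \<in> Pi\<^sub>M {0..<i} (\<lambda>_. S) \<rightarrow>\<^sub>M subprob_algebra S" for i :: nat
  proof (cases i)
    case 0
    with init show ?thesis
      by (simp add: space_prob_algebra space_subprob_algebra prob_space_imp_subprob_space)
  next
    case (Suc j)
    then show ?thesis
      by (simp add: measurable_compose[OF _ kernel_subprob] measurable_component_singleton)
  qed
  fix i :: nat and x assume "x \<in> space (Pi\<^sub>M {0..<i} (\<lambda>_. S))"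
  with init show "prob_space (if i = 0 then \<nu> else K (x (i - 1)))"
    by (auto simp: space_prob_algebra space_PiM PiE_iff intro!: prob_space_kernel)
qed

interpretation IT: Ionescu_Tulcea "\<lambda>i \<omega>. if i = 0 then \<nu> else K (\<omega> (i - 1))" "\<lambda>_. S"
  by (rule Ionescu_Tulcea)

lemma nn_integral_C_cyl:
  assumes u: "\<And>i. u i \<in> borel_measurable S"
  shows "(\<integral>\<^sup>+\<omega>. (\<Prod>i<n. u i (\<omega> i)) \<partial>IT.C 0 n (\<lambda>_. undefined)) = (\<integral>\<^sup>+x. cyl_int n u x \<partial>\<nu>)"
  using u
proof (induction n arbitrary: u)
  case 0
  then show ?case
    using init prob_space.emeasure_space_1[OF prob_space_return, of "\<lambda>_. undefined" "Pi\<^sub>M {} (\<lambda>_. S)"]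
    by (auto simp: space_prob_algebra prob_space.emeasure_space_1 space_PiM)
next
  case (Suc n)
  note [measurable] = Suc.prems
  have sp: "(\<lambda>_. undefined) \<in> space (Pi\<^sub>M {0..<0::nat} (\<lambda>_. S))"
    by (simp add: space_PiM)
  have spC: "space (IT.C 0 n (\<lambda>_. undefined)) = space (Pi\<^sub>M {0..<n} (\<lambda>_. S))"
    using IT.space_C[OF sp, of n] by simp
  have setC[measurable_cong]: "sets (IT.C 0 n (\<lambda>_. undefined)) = sets (Pi\<^sub>M {0..<n} (\<lambda>_. S))"
    using IT.sets_C[OF sp, of n] by simp
  have m: "(\<lambda>\<omega>. \<Prod>i<Suc n. u i (\<omega> i)) \<in> borel_measurable (Pi\<^sub>M {0..<Suc n} (\<lambda>_. S))"
    by measurable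
  have "(\<integral>\<^sup>+\<omega>. (\<Prod>i<Suc n. u i (\<omega> i)) \<partial>IT.C 0 (Suc n) (\<lambda>_. undefined)) =
     (\<integral>\<^sup>+\<omega>. (\<integral>\<^sup>+\<omega>'. (\<Prod>i<Suc n. u i (\<omega>' i)) \<partial>IT.eP n \<omega>) \<partial>IT.C 0 n (\<lambda>_. undefined))"
    by (simp add: nn_integral_bind[OF m] del: prod.lessThan_Suc)
  also have "\<dots> = (\<integral>\<^sup>+\<omega>. (\<Prod>i<n. u i (\<omega> i)) * (\<integral>\<^sup>+x. u n x \<partial>(if n = 0 then \<nu> else K (\<omega> (n - 1)))) \<partial>IT.C 0 n (\<lambda>_. undefined))"
  proof (intro nn_integral_cong)
    fix \<omega> assume "\<omega> \<in> space (IT.C 0 n (\<lambda>_. undefined))"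
    then have \<omega>: "\<omega> \<in> space (Pi\<^sub>M {0..<n} (\<lambda>_. S))"
      by (simp add: spC)
    define R where "R = (if n = 0 then \<nu> else K (\<omega> (n - 1)))"
    have "u n \<in> borel_measurable R"
      using IT.sets_P[OF \<omega>] unfolding R_def by (subst measurable_cong_sets[of _ S]) (use Suc.prems in auto)
    then have "(\<integral>\<^sup>+x. (\<Prod>i<n. u i (\<omega> i)) * u n x \<partial>R) = (\<Prod>i<n. u i (\<omega> i)) * (\<integral>\<^sup>+x. u n x \<partial>R)"
      by (rule nn_integral_cmult)
    then show "(\<integral>\<^sup>+\<omega>'. (\<Prod>i<Suc n. u i (\<omega>' i)) \<partial>IT.eP n \<omega>) =
       (\<Prod>i<n. u i (\<omega> i)) * (\<integral>\<^sup>+x. u n x \<partial>(if n = 0 then \<nu> else K (\<omega> (n - 1))))"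
      unfolding IT.nn_integral_eP[OF \<omega> m] R_def[symmetric] by simp
  qed
  also have "\<dots> = (\<integral>\<^sup>+x. cyl_int (Suc n) u x \<partial>\<nu>)"
  \<comment> \<open>The appended coordinate is drawn from \<open>\<nu>\<close> at time
    \<open>0\<close> and from the kernel at all later times.\<close>
  proof (cases n)
    case 0
    have "(\<integral>\<^sup>+x. u 0 x * emeasure (K x) (space (K x)) \<partial>\<nu>) = (\<integral>\<^sup>+x. u 0 x \<partial>\<nu>)"
      using init sets_eq_imp_space_eq[of \<nu> S]
      by (intro nn_integral_cong) (auto simp: space_prob_algebra space_kernel)
    with 0 sp show ?thesis
      by (simp add: nn_integral_return)
  next
    case (Suc m)
    \<comment> \<open>The integral over the new coordinate depends on coordinate \<open>m\<close>
      alone, so it is absorbed into the factor there and the induction hypothesis applies to the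
      modified factors.\<close>
    let ?u = "\<lambda>i. if i = m then (\<lambda>x. u m x * (\<integral>\<^sup>+y. u n y \<partial>K x)) else u i"
    have "?u i \<in> borel_measurable S" for i
      by (cases "i = m") simp_all
    note IH = Suc.IH[OF this]
    have "(\<integral>\<^sup>+\<omega>. (\<Prod>i<n. ?u i (\<omega> i)) \<partial>IT.C 0 n (\<lambda>_. undefined)) =
      (\<integral>\<^sup>+\<omega>. (\<Prod>i<n. u i (\<omega> i)) * (\<integral>\<^sup>+x. u n x \<partial>(if n = 0 then \<nu> else K (\<omega> (n - 1)))) \<partial>IT.C 0 n (\<lambda>_. undefined))"
      using Suc by (simp add: mult.assoc)
    moreover have "(\<integral>\<^sup>+x. cyl_int (Suc n) u x \<partial>\<nu>) = (\<integral>\<^sup>+x. cyl_int n ?u x \<partial>\<nu>)"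
      using init sets_eq_imp_space_eq[of \<nu> S] unfolding Suc
      by (intro nn_integral_cong cyl_int_Suc_last) (auto simp: space_prob_algebra)
    ultimately show ?thesis
      using IH by simp
  qed
  finally show ?case .
qed

lemma sets_chain_law [measurable_cong]: "sets (chain_law S \<nu> K) = sets paths"
  by (simp add: chain_law_def)

lemma space_chain_law: "space (chain_law S \<nu> K) = space paths"
  by (simp add: chain_law_def)

lemma nn_integral_chain_law_cyl:
  assumes [measurable]: "\<And>i. u i \<in> borel_measurable S"
  shows "(\<integral>\<^sup>+\<omega>. (\<Prod>i<n. u i (\<omega> i)) \<partial>chain_law S \<nu> K) = (\<integral>\<^sup>+x. cyl_int n u x \<partial>\<nu>)"
proof -
  \<comment> \<open>The marginal \<open>CI J\<close> is defined by restricting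
    \<open>C 0 (up_to J)\<close> to \<open>J\<close>; for an initial segment the restriction removes
    nothing.\<close>
  have "n \<le> IT.up_to {0..<n}"
    using IT.up_to_less[of "{0..<n}" "n - 1"] by (cases n) auto
  then have up: "IT.up_to {0..<n} = n"
    by (intro antisym) (auto simp: IT.up_to_iff_Ico)
  have sp: "(\<lambda>_. undefined) \<in> space (Pi\<^sub>M {0..<0::nat} (\<lambda>_. S))"
    by (simp add: space_PiM)
  have setC[measurable_cong]: "sets (IT.C 0 n (\<lambda>_. undefined)) = sets (Pi\<^sub>M {0..<n} (\<lambda>_. S))"
    using IT.sets_C[OF sp, of n] by simp
  have "(\<integral>\<^sup>+\<omega>. (\<Prod>i<n. u i (\<omega> i)) \<partial>chain_law S \<nu> K) =
     (\<integral>\<^sup>+\<omega>. (\<Prod>i<n. u i (\<omega> i)) \<partial>distr (chain_law S \<nu> K) (Pi\<^sub>M {0..<n} (\<lambda>_. S)) (\<lambda>\<omega>. restrict \<omega> {0..<n}))"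
    by (subst nn_integral_distr) (auto intro!: measurable_restrict nn_integral_cong prod.cong)
  also have "distr (chain_law S \<nu> K) (Pi\<^sub>M {0..<n} (\<lambda>_. S)) (\<lambda>\<omega>. restrict \<omega> {0..<n}) = IT.CI {0..<n}"
    unfolding chain_law_def by (rule IT.distr_lim) simp
  also have "(\<integral>\<^sup>+\<omega>. (\<Prod>i<n. u i (\<omega> i)) \<partial>IT.CI {0..<n}) = (\<integral>\<^sup>+\<omega>. (\<Prod>i<n. u i (\<omega> i)) \<partial>IT.C 0 n (\<lambda>_. undefined))"
    unfolding IT.CI_def up
    by (subst nn_integral_distr) (auto intro!: measurable_restrict nn_integral_cong prod.cong)
  finally show ?thesis
    by (simp add: nn_integral_C_cyl)
qed

lemma prob_space_chain_law: "prob_space (chain_law S \<nu> K)"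
  using nn_integral_chain_law_cyl[of "\<lambda>_ _. 1" 0] init
  by (intro prob_spaceI) (simp add: space_prob_algebra prob_space.emeasure_space_1)

end

end

lemma measurable_sequence [measurable (raw)]:
  "(\<And>i. f i \<in> M \<rightarrow>\<^sub>M S) \<Longrightarrow> (\<lambda>\<omega> i. f i \<omega>) \<in> M \<rightarrow>\<^sub>M Pi\<^sub>M UNIV (\<lambda>_. S)"
  by (rule measurable_PiM_single') (auto dest: measurable_space)

context markov_kernel
begin

lemma return_in_prob_algebra [simp]: "x \<in> space S \<Longrightarrow> return S x \<in> space (prob_algebra S)"
  by (simp add: space_prob_algebra prob_space_return)

text \<open>Cylinders form an intersection-stable generator, and the probability of a cylinder, as a
  function of the starting point, is a \<open>cyl_int\<close>, hence measurable.\<close>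

lemma measurable_chain_law_return [measurable]:
  "(\<lambda>x. chain_law S (return S x) K) \<in> S \<rightarrow>\<^sub>M prob_algebra paths"
proof (rule measurable_prob_algebra_generated[OF sets_PiM Int_stable_prod_algebra prod_algebra_sets_into_space])
  fix A assume A: "A \<in> prod_algebra (UNIV :: nat set) (\<lambda>_. S)"
  then have A': "A \<in> sets paths"
    by (simp add: sets_PiM sigma_sets.Basic)
  from A obtain J E where A_eq: "A = prod_emb UNIV (\<lambda>_. S) J (Pi\<^sub>E J E)"
    and J: "finite J" "\<And>i. i \<in> J \<Longrightarrow> E i \<in> sets S"
    by (rule prod_algebraE) auto
  show "(\<lambda>x. emeasure (chain_law S (return S x) K) A) \<in> borel_measurable S"
  proof (rule indicator_prod_emb_eq_prod[OF J, where k=0])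
    fix n u assume u [measurable]: "\<And>i. u i \<in> borel_measurable S"
      and eq: "\<And>\<omega>. \<omega> \<in> space paths \<Longrightarrow>
        indicator (prod_emb UNIV (\<lambda>_. S) J (Pi\<^sub>E J E)) \<omega> = (\<Prod>i<0 + n. u i (\<omega> i) :: ennreal)"
    have "emeasure (chain_law S (return S x) K) A = cyl_int n u x" if x: "x \<in> space S" for x
    proof -
      have "emeasure (chain_law S (return S x) K) A = (\<integral>\<^sup>+\<omega>. indicator A \<omega> \<partial>chain_law S (return S x) K)"
        using A' x by (simp add: sets_chain_law)
      also have "\<dots> = (\<integral>\<^sup>+\<omega>. (\<Prod>i<n. u i (\<omega> i)) \<partial>chain_law S (return S x) K)"
        using x by (intro nn_integral_cong) (simp add: A_eq eq space_chain_law)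
      also have "\<dots> = cyl_int n u x"
        using x by (simp add: nn_integral_chain_law_cyl nn_integral_return)
      finally show ?thesis .
    qed
    then show ?thesis
      by (subst measurable_cong) auto
  qed
qed (auto simp: sets_chain_law prob_space_chain_law)

lemma measurable_chain_law_return_subprob [measurable]:
  "(\<lambda>x. chain_law S (return S x) K) \<in> S \<rightarrow>\<^sub>M subprob_algebra paths"
  by (rule measurable_prob_algebraD) measurable

text \<open>Cylinder integrals under an initial law are mixtures of those from fixed starting
  points. Through this identity, results for every starting point reach arbitrary initial
  laws.\<close>

lemma chain_law_eq_bind:
  assumes \<nu>: "\<nu> \<in> space (prob_algebra S)"
  shows "chain_law S \<nu> K = Giry_Monad.bind \<nu> (\<lambda>x. chain_law S (return S x) K)"
proof (rule measure_eqI_cylinders[where k=0, unfolded add_0, OF prob_space_chain_law[OF \<nu>] sets_chain_law[OF \<nu>]])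
  have sp: "space \<nu> = space S"
    using \<nu> by (auto simp: space_prob_algebra intro!: sets_eq_imp_space_eq)
  have [measurable_cong]: "sets \<nu> = sets S"
    using \<nu> by (auto simp: space_prob_algebra)
  show "sets (Giry_Monad.bind \<nu> (\<lambda>x. chain_law S (return S x) K)) = sets paths"
    by (rule sets_bind'[OF \<nu> measurable_chain_law_return])
  fix n and u :: "nat \<Rightarrow> 's \<Rightarrow> ennreal" assume u [measurable]: "\<And>i. u i \<in> borel_measurable S"
  have "(\<integral>\<^sup>+\<omega>. (\<Prod>i<n. u i (\<omega> i)) \<partial>(Giry_Monad.bind \<nu> (\<lambda>x. chain_law S (return S x) K))) =
    (\<integral>\<^sup>+x. (\<integral>\<^sup>+\<omega>. (\<Prod>i<n. u i (\<omega> i)) \<partial>chain_law S (return S x) K) \<partial>\<nu>)"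
    using measurable_prob_algebraD[OF measurable_chain_law_return]
    by (subst nn_integral_bind[where B=paths]) (auto cong: measurable_cong_sets)
  also have "\<dots> = (\<integral>\<^sup>+x. cyl_int n u x \<partial>\<nu>)"
    by (intro nn_integral_cong) (simp add: nn_integral_chain_law_cyl nn_integral_return sp)
  finally show "(\<integral>\<^sup>+\<omega>. (\<Prod>i<n. u i (\<omega> i)) \<partial>chain_law S \<nu> K) =
      (\<integral>\<^sup>+\<omega>. (\<Prod>i<n. u i (\<omega> i)) \<partial>(Giry_Monad.bind \<nu> (\<lambda>x. chain_law S (return S x) K)))"
    by (simp add: nn_integral_chain_law_cyl[OF \<nu>])
qed

lemma emeasure_chain_law:
  assumes \<nu>: "\<nu> \<in> space (prob_algebra S)" and A: "A \<in> sets paths"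
  shows "emeasure (chain_law S \<nu> K) A = (\<integral>\<^sup>+x. emeasure (chain_law S (return S x) K) A \<partial>\<nu>)"
  by (subst chain_law_eq_bind[OF \<nu>]) (rule emeasure_bind_prob_algebra[OF \<nu> measurable_chain_law_return A])

text \<open>\<open>comb_seq k\<close> keeps the coordinates before time \<open>k\<close> and
  continues with the second path from time \<open>k\<close> on. The fresh path starts at
  \<open>\<omega> k\<close>, so it contributes the \<open>cyl_int\<close> of the remaining factors
  at that point, and \<open>cyl_int_add\<close> reassembles the full product.\<close>

lemma chain_law_restart:
  assumes \<nu>: "\<nu> \<in> space (prob_algebra S)"
  shows "chain_law S \<nu> K = Giry_Monad.bind (chain_law S \<nu> K)
    (\<lambda>\<omega>. distr (chain_law S (return S (\<omega> k)) K) paths (comb_seq k \<omega>))" (is "?P = Giry_Monad.bind ?P ?Q")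
proof (rule measure_eqI_cylinders[where k=k, OF prob_space_chain_law[OF \<nu>] sets_chain_law[OF \<nu>]])
  note [measurable_cong] = sets_chain_law[OF \<nu>]
  have P: "?P \<in> space (prob_algebra paths)"
    using \<nu> by (simp add: space_prob_algebra sets_chain_law prob_space_chain_law)
  have sp: "space ?P = space paths"
    by (rule space_chain_law[OF \<nu>])
  have Q: "?Q \<in> paths \<rightarrow>\<^sub>M prob_algebra paths"
    by measurable
  show "sets (Giry_Monad.bind ?P ?Q) = sets paths"
    by (rule sets_bind'[OF P Q])
  fix n and u :: "nat \<Rightarrow> 's \<Rightarrow> ennreal" assume u [measurable]: "\<And>i. u i \<in> borel_measurable S"
  let ?u = "\<lambda>i. if i < k then u i else cyl_int n (\<lambda>j. u (k + j))"
  have u' [measurable]: "?u i \<in> borel_measurable S" for i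
    by (cases "i < k") simp_all
  have "(\<integral>\<^sup>+\<omega>. (\<Prod>i<k + n. u i (\<omega> i)) \<partial>Giry_Monad.bind ?P ?Q) =
    (\<integral>\<^sup>+\<omega>. (\<integral>\<^sup>+\<omega>'. (\<Prod>i<k + n. u i (\<omega>' i)) \<partial>?Q \<omega>) \<partial>?P)"
    using measurable_prob_algebraD[OF Q]
    by (subst nn_integral_bind[where B=paths]) (auto cong: measurable_cong_sets)
  also have "\<dots> = (\<integral>\<^sup>+\<omega>. (\<Prod>i<Suc k. ?u i (\<omega> i)) \<partial>?P)"
  proof (intro nn_integral_cong)
    fix \<omega> assume "\<omega> \<in> space ?P"
    then have \<omega> [measurable]: "\<omega> \<in> space paths" and \<omega>k: "\<omega> k \<in> space S"
      by (auto simp: sp space_PiM)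
    note [measurable_cong] = sets_chain_law[OF return_in_prob_algebra[OF \<omega>k]]
    have "(\<integral>\<^sup>+\<omega>'. (\<Prod>i<k + n. u i (\<omega>' i)) \<partial>?Q \<omega>) =
      (\<integral>\<^sup>+\<omega>'. (\<Prod>i<k + n. u i (comb_seq k \<omega> \<omega>' i)) \<partial>chain_law S (return S (\<omega> k)) K)"
      by (subst nn_integral_distr) auto
    also have "\<dots> = (\<integral>\<^sup>+\<omega>'. (\<Prod>i<k. u i (\<omega> i)) * (\<Prod>j<n. u (k + j) (\<omega>' j)) \<partial>chain_law S (return S (\<omega> k)) K)"
      by (simp add: prod_lessThan_add comb_seq_def)
    also have "\<dots> = (\<Prod>i<k. u i (\<omega> i)) * (\<integral>\<^sup>+\<omega>'. (\<Prod>j<n. u (k + j) (\<omega>' j)) \<partial>chain_law S (return S (\<omega> k)) K)"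
      by (rule nn_integral_cmult) measurable
    also have "(\<integral>\<^sup>+\<omega>'. (\<Prod>j<n. u (k + j) (\<omega>' j)) \<partial>chain_law S (return S (\<omega> k)) K) = cyl_int n (\<lambda>j. u (k + j)) (\<omega> k)"
      using nn_integral_chain_law_cyl[OF return_in_prob_algebra[OF \<omega>k], of "\<lambda>j. u (k + j)" n] \<omega>k
      by (simp add: nn_integral_return)
    finally show "(\<integral>\<^sup>+\<omega>'. (\<Prod>i<k + n. u i (\<omega>' i)) \<partial>?Q \<omega>) = (\<Prod>i<Suc k. ?u i (\<omega> i))"
      by simp
  qed
  also have "\<dots> = (\<integral>\<^sup>+x. cyl_int (Suc k) ?u x \<partial>\<nu>)"
    by (rule nn_integral_chain_law_cyl[OF \<nu> u'])
  also have "\<dots> = (\<integral>\<^sup>+x. cyl_int (k + n) u x \<partial>\<nu>)"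
    using \<nu> sets_eq_imp_space_eq[of \<nu> S]
    by (intro nn_integral_cong cyl_int_add[symmetric]) (auto simp: space_prob_algebra)
  also have "\<dots> = (\<integral>\<^sup>+\<omega>. (\<Prod>i<k + n. u i (\<omega> i)) \<partial>?P)"
    by (rule nn_integral_chain_law_cyl[OF \<nu> u, symmetric])
  finally show "(\<integral>\<^sup>+\<omega>. (\<Prod>i<k + n. u i (\<omega> i)) \<partial>?P) = (\<integral>\<^sup>+\<omega>. (\<Prod>i<k + n. u i (\<omega> i)) \<partial>Giry_Monad.bind ?P ?Q)" ..
qed

text \<open>Splicing in a fresh path from time \<open>k\<close> cannot change membership in
  \<open>D\<close>, which is decided earlier, and shifting the spliced path by \<open>k\<close>
  returns the fresh path. So the spliced law of \<open>chain_law_restart\<close> factors on such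
  events.\<close>

lemma markov_property:
  assumes \<nu>: "\<nu> \<in> space (prob_algebra S)"
    and A [measurable]: "A \<in> sets paths" and D [measurable]: "D \<in> sets paths"
    and past: "\<And>\<omega> \<omega>'. \<omega> \<in> D \<Longrightarrow> \<omega>' \<in> space paths \<Longrightarrow> (\<And>i. i < k \<Longrightarrow> \<omega> i = \<omega>' i) \<Longrightarrow> \<omega>' \<in> D"
  shows "emeasure (chain_law S \<nu> K) {\<omega> \<in> D. (\<lambda>i. \<omega> (k + i)) \<in> A} =
    (\<integral>\<^sup>+\<omega>. indicator D \<omega> * emeasure (chain_law S (return S (\<omega> k)) K) A \<partial>chain_law S \<nu> K)" (is "emeasure ?P ?E = _")
proof -
  let ?Q = "\<lambda>\<omega>. distr (chain_law S (return S (\<omega> k)) K) paths (comb_seq k \<omega>)"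
  note [measurable_cong] = sets_chain_law[OF \<nu>]
  have P: "?P \<in> space (prob_algebra paths)"
    using \<nu> by (simp add: space_prob_algebra sets_chain_law prob_space_chain_law)
  have sp: "space ?P = space paths"
    by (rule space_chain_law[OF \<nu>])
  have Q: "?Q \<in> paths \<rightarrow>\<^sub>M prob_algebra paths"
    by measurable
  have "{\<omega> \<in> space paths. \<omega> \<in> D \<and> (\<lambda>i. \<omega> (k + i)) \<in> A} \<in> sets paths"
    by measurable
  also have "{\<omega> \<in> space paths. \<omega> \<in> D \<and> (\<lambda>i. \<omega> (k + i)) \<in> A} = ?E"
    using sets.sets_into_space[OF D] by auto
  finally have E [measurable]: "?E \<in> sets paths" .
  have "emeasure ?P ?E = (\<integral>\<^sup>+\<omega>. emeasure (?Q \<omega>) ?E \<partial>?P)"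
    by (subst chain_law_restart[OF \<nu>, of k]) (rule emeasure_bind_prob_algebra[OF P Q E])
  also have "\<dots> = (\<integral>\<^sup>+\<omega>. indicator D \<omega> * emeasure (chain_law S (return S (\<omega> k)) K) A \<partial>?P)"
  proof (intro nn_integral_cong)
    fix \<omega> assume "\<omega> \<in> space ?P"
    then have \<omega> [measurable]: "\<omega> \<in> space paths" and \<omega>k: "\<omega> k \<in> space S"
      by (auto simp: sp space_PiM)
    note [measurable_cong] = sets_chain_law[OF return_in_prob_algebra[OF \<omega>k]]
    have spk: "space (chain_law S (return S (\<omega> k)) K) = space paths"
      using \<omega>k by (simp add: space_chain_law)
    have "emeasure (?Q \<omega>) ?E = emeasure (chain_law S (return S (\<omega> k)) K) (comb_seq k \<omega> -` ?E \<inter> space paths)"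
      by (subst emeasure_distr) (auto simp: spk)
    also have "comb_seq k \<omega> -` ?E \<inter> space paths = (if \<omega> \<in> D then A else {})"
    proof -
      have "comb_seq k \<omega> \<omega>' \<in> D \<longleftrightarrow> \<omega> \<in> D" if "\<omega>' \<in> space paths" for \<omega>'
      proof -
        have "comb_seq k \<omega> \<omega>' \<in> space paths"
          using \<omega> that by (auto simp: space_PiM PiE_iff comb_seq_def)
        with \<omega> show ?thesis
          by (auto intro: past simp: comb_seq_less)
      qed
      then show ?thesis
        using sets.sets_into_space[OF A] by (auto simp: comb_seq_def[abs_def])
    qed
    finally show "emeasure (?Q \<omega>) ?E = indicator D \<omega> * emeasure (chain_law S (return S (\<omega> k)) K) A"
      by (auto simp: indicator_def)
  qed
  finally show ?thesis .
qed

lemma distr_chain_law_shift: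
  assumes inv: "invariant_probability S K \<nu>"
  shows "distr (chain_law S \<nu> K) paths (\<lambda>\<omega> i. \<omega> (Suc i)) = chain_law S \<nu> K"
proof (rule measure_eqI_cylinders[where k=0, unfolded add_0])
  have \<nu>: "\<nu> \<in> space (prob_algebra S)"
    using inv by (auto simp: invariant_probability_def space_prob_algebra)
  have sp: "space \<nu> = space S" and [measurable_cong]: "sets \<nu> = sets S"
    using \<nu> by (auto simp: space_prob_algebra intro!: sets_eq_imp_space_eq)
  note [measurable_cong] = sets_chain_law[OF \<nu>]
  have "Giry_Monad.bind \<nu> K = \<nu>"
  proof (rule measure_eqI)
    show *: "sets (Giry_Monad.bind \<nu> K) = sets \<nu>"
      using sets_bind'[OF \<nu> kernel] \<open>sets \<nu> = sets S\<close> by simp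
    show "emeasure (Giry_Monad.bind \<nu> K) A = emeasure \<nu> A" if "A \<in> sets (Giry_Monad.bind \<nu> K)" for A
      using that inv emeasure_bind_prob_algebra[OF \<nu> kernel, of A] *
      by (simp add: invariant_probability_def)
  qed
  then have step: "(\<integral>\<^sup>+x. (\<integral>\<^sup>+y. v y \<partial>K x) \<partial>\<nu>) = (\<integral>\<^sup>+x. v x \<partial>\<nu>)" if [measurable]: "v \<in> borel_measurable S" for v
    using nn_integral_bind[of v S K \<nu>] by simp
  show "prob_space (distr (chain_law S \<nu> K) paths (\<lambda>\<omega> i. \<omega> (Suc i)))"
    by (rule prob_space.prob_space_distr[OF prob_space_chain_law[OF \<nu>]]) measurable
  show "sets (distr (chain_law S \<nu> K) paths (\<lambda>\<omega> i. \<omega> (Suc i))) = sets paths"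
    "sets (chain_law S \<nu> K) = sets paths"
    by (simp_all add: sets_chain_law \<nu>)
  fix n and u :: "nat \<Rightarrow> 's \<Rightarrow> ennreal" assume u [measurable]: "\<And>i. u i \<in> borel_measurable S"
  \<comment> \<open>A trivial factor at time \<open>0\<close> turns a product along the shifted path
    into a cylinder of length \<open>Suc n\<close>; \<open>step\<close> then removes the first
    transition by invariance.\<close>
  let ?u = "\<lambda>i. case i of 0 \<Rightarrow> (\<lambda>_. 1) | Suc j \<Rightarrow> u j"
  have u': "?u i \<in> borel_measurable S" for i
    by (cases i) simp_all
  have "(\<integral>\<^sup>+\<omega>. (\<Prod>i<n. u i (\<omega> i)) \<partial>distr (chain_law S \<nu> K) paths (\<lambda>\<omega> i. \<omega> (Suc i))) =
    (\<integral>\<^sup>+\<omega>. (\<Prod>i<Suc n. ?u i (\<omega> i)) \<partial>chain_law S \<nu> K)"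
    by (subst nn_integral_distr) (auto simp: prod.lessThan_Suc_shift simp del: prod.lessThan_Suc)
  also have "\<dots> = (\<integral>\<^sup>+x. cyl_int n u x \<partial>\<nu>)"
    by (simp add: nn_integral_chain_law_cyl[OF \<nu> u'] step del: prod.lessThan_Suc)
  finally show "(\<integral>\<^sup>+\<omega>. (\<Prod>i<n. u i (\<omega> i)) \<partial>distr (chain_law S \<nu> K) paths (\<lambda>\<omega> i. \<omega> (Suc i))) =
    (\<integral>\<^sup>+\<omega>. (\<Prod>i<n. u i (\<omega> i)) \<partial>chain_law S \<nu> K)"
    by (simp add: nn_integral_chain_law_cyl[OF \<nu>])
qed

end

text \<open>Dynkin's criterion for a function of a Markov chain to be a Markov chain.\<close>

lemma distr_chain_law_lumping:
  fixes T :: "'t measure" and L :: "'t \<Rightarrow> 't measure" and \<phi> :: "'t \<Rightarrow> 's"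
  assumes "markov_kernel S K" "markov_kernel T L"
    and \<nu>: "\<nu> \<in> space (prob_algebra T)" and \<phi> [measurable]: "\<phi> \<in> T \<rightarrow>\<^sub>M S"
    and lump: "\<And>x. x \<in> space T \<Longrightarrow> distr (L x) S \<phi> = K (\<phi> x)"
  shows "distr (chain_law T \<nu> L) (Pi\<^sub>M UNIV (\<lambda>_. S)) (\<lambda>\<omega> i. \<phi> (\<omega> i)) = chain_law S (distr \<nu> S \<phi>) K"
proof -
  interpret S: markov_kernel S K by fact
  interpret T: markov_kernel T L by fact
  note [measurable_cong] = T.sets_chain_law[OF \<nu>]
  have sp: "space \<nu> = space T" and [measurable_cong]: "sets \<nu> = sets T"
    using \<nu> by (auto simp: space_prob_algebra intro!: sets_eq_imp_space_eq)
  have \<nu>': "distr \<nu> S \<phi> \<in> space (prob_algebra S)"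
    using \<nu> by (auto simp: space_prob_algebra intro!: prob_space.prob_space_distr)
  \<comment> \<open>Each transition of \<open>L\<close>, pushed forward by \<open>\<phi>\<close>, is
    a transition of \<open>K\<close>, so integrals of functions of \<open>\<phi>\<close> descend one
    transition at a time.\<close>
  have cyl: "T.cyl_int n (\<lambda>i x. u i (\<phi> x)) x = S.cyl_int n u (\<phi> x)"
    if "x \<in> space T" "\<And>i. u i \<in> borel_measurable S" for n u x
    using that
  proof (induction n arbitrary: u x)
    case (Suc n)
    note [measurable] = Suc.prems(2)
    have "(\<integral>\<^sup>+y. T.cyl_int n (\<lambda>i x. u (Suc i) (\<phi> x)) y \<partial>L x) = (\<integral>\<^sup>+y. S.cyl_int n (\<lambda>i. u (Suc i)) (\<phi> y) \<partial>L x)"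
      using Suc.prems by (intro nn_integral_cong Suc.IH) (auto simp: T.space_kernel)
    also have "\<dots> = (\<integral>\<^sup>+z. S.cyl_int n (\<lambda>i. u (Suc i)) z \<partial>distr (L x) S \<phi>)"
      using Suc.prems(1) T.sets_kernel[OF Suc.prems(1), measurable_cong] by (subst nn_integral_distr) auto
    finally show ?case
      using Suc.prems(1) by (simp add: lump)
  qed simp
  show ?thesis
  proof (rule measure_eqI_cylinders[where k=0, unfolded add_0])
    show "prob_space (distr (chain_law T \<nu> L) S.paths (\<lambda>\<omega> i. \<phi> (\<omega> i)))"
      by (rule prob_space.prob_space_distr[OF T.prob_space_chain_law[OF \<nu>]]) measurable
    show "sets (distr (chain_law T \<nu> L) S.paths (\<lambda>\<omega> i. \<phi> (\<omega> i))) = sets S.paths"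
      "sets (chain_law S (distr \<nu> S \<phi>) K) = sets S.paths"
      by (simp_all add: S.sets_chain_law \<nu>')
    fix n and u :: "nat \<Rightarrow> 's \<Rightarrow> ennreal" assume u [measurable]: "\<And>i. u i \<in> borel_measurable S"
    have "(\<integral>\<^sup>+\<omega>. (\<Prod>i<n. u i (\<omega> i)) \<partial>distr (chain_law T \<nu> L) S.paths (\<lambda>\<omega> i. \<phi> (\<omega> i))) =
      (\<integral>\<^sup>+\<omega>. (\<Prod>i<n. u i (\<phi> (\<omega> i))) \<partial>chain_law T \<nu> L)"
      by (subst nn_integral_distr) auto
    also have "\<dots> = (\<integral>\<^sup>+x. T.cyl_int n (\<lambda>i x. u i (\<phi> x)) x \<partial>\<nu>)"
      by (rule T.nn_integral_chain_law_cyl[OF \<nu>]) measurable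
    also have "\<dots> = (\<integral>\<^sup>+x. S.cyl_int n u (\<phi> x) \<partial>\<nu>)"
      by (intro nn_integral_cong cyl) (auto simp: sp)
    also have "\<dots> = (\<integral>\<^sup>+\<omega>. (\<Prod>i<n. u i (\<omega> i)) \<partial>chain_law S (distr \<nu> S \<phi>) K)"
      by (simp add: S.nn_integral_chain_law_cyl[OF \<nu>'] nn_integral_distr)
    finally show "(\<integral>\<^sup>+\<omega>. (\<Prod>i<n. u i (\<omega> i)) \<partial>distr (chain_law T \<nu> L) S.paths (\<lambda>\<omega> i. \<phi> (\<omega> i))) =
      (\<integral>\<^sup>+\<omega>. (\<Prod>i<n. u i (\<omega> i)) \<partial>chain_law S (distr \<nu> S \<phi>) K)" .
  qed
qed

section \<open>Zero-one law for Harris recurrent chains\<close>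

text \<open>The events decided before time \<open>n\<close>, described by saturation under agreement
  of paths rather than as a generated sigma-algebra: this is the form in which
  \<open>markov_property\<close> expects its past event.\<close>

definition past :: "'s measure \<Rightarrow> nat \<Rightarrow> (nat \<Rightarrow> 's) set set" where
  "past S n = {D \<in> sets (Pi\<^sub>M UNIV (\<lambda>_. S)).
     \<forall>\<omega>\<in>D. \<forall>\<omega>'\<in>space (Pi\<^sub>M UNIV (\<lambda>_. S)). (\<forall>i<n. \<omega> i = \<omega>' i) \<longrightarrow> \<omega>' \<in> D}"

lemma past_sets: "D \<in> past S n \<Longrightarrow> D \<in> sets (Pi\<^sub>M UNIV (\<lambda>_. S))"
  by (simp add: past_def)

lemma past_mono: "n \<le> m \<Longrightarrow> past S n \<subseteq> past S m"
  by (auto simp: past_def)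

lemma past_Compl:
  assumes "D \<in> past S n"
  shows "space (Pi\<^sub>M UNIV (\<lambda>_. S)) - D \<in> past S n" (is "?X - D \<in> _")
proof -
  have "\<omega>' \<in> ?X - D" if "\<omega> \<in> ?X - D" "\<omega>' \<in> ?X" "\<forall>i<n. \<omega> i = \<omega>' i" for \<omega> \<omega>'
  proof -
    have "\<forall>i<n. \<omega>' i = \<omega> i"
      using that(3) by simp
    then have "\<omega>' \<notin> D"
      using assms that(1) by (auto simp: past_def)
    with that(2) show ?thesis
      by simp
  qed
  then show ?thesis
    using past_sets[OF assms] unfolding past_def by blast
qed

lemma past_UN:
  assumes D: "\<And>i. i \<in> I \<Longrightarrow> D i \<in> past S n" and "countable I"
  shows "(\<Union>i\<in>I. D i) \<in> past S n"
proof -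
  have "(\<Union>i\<in>I. D i) \<in> sets (Pi\<^sub>M UNIV (\<lambda>_. S))"
    using assms past_sets[of _ S n] by (intro sets.countable_UN') auto
  moreover have "\<omega>' \<in> (\<Union>i\<in>I. D i)"
    if "\<omega> \<in> (\<Union>i\<in>I. D i)" "\<omega>' \<in> space (Pi\<^sub>M UNIV (\<lambda>_. S))" "\<forall>i<n. \<omega> i = \<omega>' i" for \<omega> \<omega>'
  proof -
    obtain i where "i \<in> I" "\<omega> \<in> D i"
      using \<open>\<omega> \<in> (\<Union>i\<in>I. D i)\<close> by blast
    with D[of i] that(2,3) have "\<omega>' \<in> D i"
      by (simp add: past_def)
    with \<open>i \<in> I\<close> show ?thesis
      by blast
  qed
  ultimately show ?thesis
    unfolding past_def by blast
qed

text \<open>The events that can be approximated in probability by events of finite horizon contain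
  the coordinate events and are closed under complements and countable unions; the proof is
  induction over the generated sigma-algebra.\<close>

lemma past_approximation:
  fixes Q :: "(nat \<Rightarrow> 's) measure"
  assumes "prob_space Q" and Q: "sets Q = sets (Pi\<^sub>M UNIV (\<lambda>_. S))"
    and A: "A \<in> sets (Pi\<^sub>M UNIV (\<lambda>_. S))" and "0 < \<epsilon>"
  shows "\<exists>n. \<exists>D\<in>past S n. measure Q (sym_diff A D) < \<epsilon>"
proof -
  interpret prob_space Q by fact
  let ?X = "Pi\<^sub>M (UNIV :: nat set) (\<lambda>_. S)"
  have [simp]: "D \<in> sets Q" if "D \<in> past S n" for D n
    using past_sets[OF that] by (simp add: Q)
  from A have "A \<in> sigma_sets (\<Pi>\<^sub>E i\<in>(UNIV :: nat set). space S)
      {{f \<in> \<Pi>\<^sub>E i\<in>UNIV. space S. f i \<in> B} |i B. i \<in> UNIV \<and> B \<in> sets S}"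
    by (simp add: sets_PiM_single)
  then show ?thesis
    using \<open>0 < \<epsilon>\<close>
  proof (induction arbitrary: \<epsilon>)
    case (Basic A)
    then obtain i B where A: "A = {f \<in> space ?X. f i \<in> B}" "B \<in> sets S"
      by (auto simp: space_PiM)
    then have "A \<in> sets ?X"
      by simp
    then have "A \<in> past S (Suc i)"
      using A by (auto simp: past_def)
    with Basic show ?case
      by (intro exI bexI[of _ A]) auto
  next
    case Empty
    then show ?case
      by (intro exI[of _ 0] bexI[of _ "{}"]) (auto simp: past_def)
  next
    case (Compl A)
    then obtain n D where D: "D \<in> past S n" "measure Q (sym_diff A D) < \<epsilon>"
      by blast
    have "A \<subseteq> space ?X"
      using Compl.hyps unfolding space_PiM by (rule sigma_sets_into_sp[rotated]) auto
    moreover have "D \<subseteq> space ?X"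
      using past_sets[OF D(1)] by (rule sets.sets_into_space)
    ultimately have "sym_diff ((\<Pi>\<^sub>E i\<in>UNIV. space S) - A) (space ?X - D) = sym_diff A D"
      by (auto simp: space_PiM)
    with D show ?case
      by (intro exI bexI[of _ "space ?X - D"] past_Compl) simp
  next
    case (Union A)
    have A [measurable]: "A i \<in> sets Q" for i
      using Union.hyps by (simp add: Q sets_PiM_single)
    have "(\<lambda>N. measure Q (\<Union>i<N. A i)) \<longlonglongrightarrow> measure Q (\<Union>N. \<Union>i<N. A i)"
      by (intro finite_Lim_measure_incseq) (auto simp: incseq_def intro: less_le_trans)
    also have "(\<Union>N. \<Union>i<N. A i) = (\<Union>i. A i)"
      by auto
    finally have "\<forall>\<^sub>F N in sequentially. dist (measure Q (\<Union>i<N. A i)) (measure Q (\<Union>i. A i)) < \<epsilon> / 2"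
      using Union.prems by (intro tendstoD) auto
    then obtain N where N: "\<bar>measure Q (\<Union>i<N. A i) - measure Q (\<Union>i. A i)\<bar> < \<epsilon> / 2"
      by (auto simp: eventually_sequentially dist_real_def)
    \<comment> \<open>Half of \<open>\<epsilon>\<close> pays for truncating the union to its first
      \<open>N\<close> members, the other half is shared among these. Dividing by
      \<open>Suc N\<close> instead of \<open>N\<close> covers the case \<open>N = 0\<close>.\<close>
    have "\<exists>n. \<exists>D\<in>past S n. measure Q (sym_diff (A i) D) < \<epsilon> / (2 * Suc N)" for i
      using Union.prems by (intro Union.IH) simp
    then obtain n D where D: "\<And>i. D i \<in> past S (n i)" "\<And>i. measure Q (sym_diff (A i) (D i)) < \<epsilon> / (2 * Suc N)"
      by metis
    have [measurable]: "D i \<in> sets Q" for i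
      using past_sets[OF D(1)] by (simp add: Q)
    \<comment> \<open>The sum of the horizons is merely a convenient upper bound for all of
      them.\<close>
    have "D i \<in> past S (\<Sum>i<N. n i)" if "i < N" for i
      using D(1) that past_mono[of "n i" "\<Sum>i<N. n i" S] member_le_sum[of i "{..<N}" n] by auto
    then have U: "(\<Union>i<N. D i) \<in> past S (\<Sum>i<N. n i)"
      by (intro past_UN) auto
    have "measure Q (sym_diff (\<Union>i. A i) (\<Union>i<N. D i)) \<le>
        measure Q (((\<Union>i. A i) - (\<Union>i<N. A i)) \<union> (\<Union>i<N. sym_diff (A i) (D i)))"
      by (intro finite_measure_mono) (blast, measurable)
    also have "\<dots> \<le> measure Q ((\<Union>i. A i) - (\<Union>i<N. A i)) + measure Q (\<Union>i<N. sym_diff (A i) (D i))"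
      by (intro measure_Un_le) auto
    also have "measure Q ((\<Union>i. A i) - (\<Union>i<N. A i)) = measure Q (\<Union>i. A i) - measure Q (\<Union>i<N. A i)"
      by (intro finite_measure_Diff) auto
    also have "\<dots> < \<epsilon> / 2"
      using N by linarith
    also have "measure Q (\<Union>i<N. sym_diff (A i) (D i)) \<le> (\<Sum>i<N. measure Q (sym_diff (A i) (D i)))"
      by (intro measure_UNION_le) auto
    also have "\<dots> \<le> (\<Sum>i<N. \<epsilon> / (2 * Suc N))"
      using D(2) by (intro sum_mono less_imp_le)
    also have "\<dots> \<le> \<epsilon> / 2"
      using Union.prems by (simp add: field_simps)
    finally show ?case
      using U by (intro exI bexI) simp_all
  qed
qed

section \<open>Invariant events and recurrence\<close>

context markov_kernel
begin

lemma emeasure_chain_law_0: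
  assumes x: "x \<in> space S" and C: "C \<in> sets S"
  shows "emeasure (chain_law S (return S x) K) {\<omega> \<in> space paths. \<omega> 0 \<in> C} = indicator C x"
proof -
  let ?P = "chain_law S (return S x) K"
  note [measurable_cong] = sets_chain_law[OF return_in_prob_algebra[OF x]]
  have sp: "space ?P = space paths"
    using x by (simp add: space_chain_law)
  have "emeasure ?P {\<omega> \<in> space paths. \<omega> 0 \<in> C} = (\<integral>\<^sup>+\<omega>. indicator {\<omega> \<in> space paths. \<omega> 0 \<in> C} \<omega> \<partial>?P)"
    using C by (subst nn_integral_indicator) auto
  also have "\<dots> = (\<integral>\<^sup>+\<omega>. (\<Prod>i<Suc 0. indicator C (\<omega> i)) \<partial>?P)"
    by (intro nn_integral_cong) (auto simp: sp indicator_def)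
  also have "\<dots> = indicator C x"
    using x C nn_integral_chain_law_cyl[OF return_in_prob_algebra[OF x], of "\<lambda>_. indicator C" "Suc 0"]
    by (simp add: nn_integral_return space_kernel del: prod.lessThan_Suc)
  finally show ?thesis .
qed

lemma invariant_shift:
  assumes inv: "\<And>\<omega>. \<omega> \<in> space paths \<Longrightarrow> (\<lambda>i. \<omega> (Suc i)) \<in> A \<longleftrightarrow> \<omega> \<in> A" and "\<omega> \<in> space paths"
  shows "(\<lambda>i. \<omega> (k + i)) \<in> A \<longleftrightarrow> \<omega> \<in> A"
  using assms(2)
proof (induction k arbitrary: \<omega>)
  case (Suc k)
  then have "(\<lambda>i. \<omega> (Suc i)) \<in> space paths"
    by (auto simp: space_PiM)
  from Suc.IH[OF this] inv[OF Suc.prems] show ?case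
    by simp
qed simp

text \<open>Decomposing according to the first visit to \<open>C\<close> after time \<open>n\<close>.\<close>

lemma emeasure_invariant_event_Int_past:
  assumes \<nu>: "\<nu> \<in> space (prob_algebra S)"
    and A [measurable]: "A \<in> sets paths"
    and inv: "\<And>\<omega>. \<omega> \<in> space paths \<Longrightarrow> (\<lambda>i. \<omega> (Suc i)) \<in> A \<longleftrightarrow> \<omega> \<in> A"
    and C [measurable]: "C \<in> sets S"
    and le: "\<And>y. y \<in> C \<Longrightarrow> emeasure (chain_law S (return S y) K) A \<le> c"
    and rec: "AE \<omega> in chain_law S \<nu> K. infinite {n. \<omega> n \<in> C}"
    and D: "D \<in> past S n"
  shows "emeasure (chain_law S \<nu> K) (A \<inter> D) \<le> c * emeasure (chain_law S \<nu> K) D"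
proof -
  let ?P = "chain_law S \<nu> K"
  note [measurable_cong] = sets_chain_law[OF \<nu>]
  have sp: "space ?P = space paths"
    by (rule space_chain_law[OF \<nu>])
  have D_sets [measurable]: "D \<in> sets paths"
    using D by (rule past_sets)
  then have D_space: "D \<subseteq> space paths"
    by (rule sets.sets_into_space)
  \<comment> \<open>\<open>F k\<close> says that the first visit at or after time \<open>n\<close>
    takes place at \<open>n + k\<close>. Only its part \<open>E k\<close> is decided before time
    \<open>n + k\<close>; the visit itself is expressed by the event \<open>?C\<close> of the
    restarted path.\<close>
  define F where "F k = {\<omega> \<in> D. (\<forall>j<k. \<omega> (n + j) \<notin> C) \<and> \<omega> (n + k) \<in> C}" for k
  define E where "E k = {\<omega> \<in> D. \<forall>j<k. \<omega> (n + j) \<notin> C}" for k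
  have F_eq: "F k = {\<omega> \<in> space paths. \<omega> \<in> D \<and> (\<forall>j<k. \<omega> (n + j) \<notin> C) \<and> \<omega> (n + k) \<in> C}" for k
    using D_space by (auto simp: F_def)
  have F [measurable]: "F k \<in> sets paths" for k
    unfolding F_eq by measurable
  have E_eq: "E k = {\<omega> \<in> space paths. \<omega> \<in> D \<and> (\<forall>j<k. \<omega> (n + j) \<notin> C)}" for k
    using D_space by (auto simp: E_def)
  have E [measurable]: "E k \<in> sets paths" for k
    unfolding E_eq by measurable
  have E_past: "\<omega>' \<in> E k" if "\<omega> \<in> E k" "\<omega>' \<in> space paths" "\<And>i. i < n + k \<Longrightarrow> \<omega> i = \<omega>' i" for \<omega> \<omega>' k
  proof -
    have "\<omega>' \<in> D"
      using D that by (auto simp: past_def E_def)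
    moreover have "\<omega>' (n + j) \<notin> C" if "j < k" for j
      using \<open>\<omega> \<in> E k\<close> that \<open>\<And>i. i < n + k \<Longrightarrow> \<omega> i = \<omega>' i\<close>[of "n + j"] by (auto simp: E_def)
    ultimately show ?thesis
      by (simp add: E_def)
  qed
  let ?C = "{\<omega> \<in> space paths. \<omega> 0 \<in> C}"
  \<comment> \<open>A path started at \<open>y\<close> satisfies \<open>?C\<close> with probability
    \<open>indicator C y\<close>, so the bound is the assumption \<open>le\<close> on
    \<open>C\<close> and reads \<open>0 \<le> 0\<close> elsewhere.\<close>
  have le': "emeasure (chain_law S (return S y) K) (A \<inter> ?C) \<le> c * emeasure (chain_law S (return S y) K) ?C"
    if y: "y \<in> space S" for y
  proof (cases "y \<in> C")
    case True
    have "emeasure (chain_law S (return S y) K) (A \<inter> ?C) \<le> emeasure (chain_law S (return S y) K) A"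
      using y by (intro emeasure_mono) (auto simp: sets_chain_law)
    also have "\<dots> \<le> c"
      using True by (rule le)
    finally show ?thesis
      using True y by (simp add: emeasure_chain_law_0)
  next
    case False
    have "emeasure (chain_law S (return S y) K) (A \<inter> ?C) \<le> emeasure (chain_law S (return S y) K) ?C"
      using y by (intro emeasure_mono) (auto simp: sets_chain_law)
    with False y show ?thesis
      by (simp add: emeasure_chain_law_0)
  qed
  have shift_E: "{\<omega> \<in> E k. (\<lambda>i. \<omega> (n + k + i)) \<in> A \<inter> ?C} = A \<inter> F k" "{\<omega> \<in> E k. (\<lambda>i. \<omega> (n + k + i)) \<in> ?C} = F k" for k
  proof -
    have "(\<lambda>i. \<omega> (n + k + i)) \<in> space paths" "(\<lambda>i. \<omega> (n + k + i)) \<in> A \<longleftrightarrow> \<omega> \<in> A" if "\<omega> \<in> D" for \<omega>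
      using invariant_shift[OF inv, of \<omega> "n + k"] D_space that by (auto simp: space_PiM)
    then show "{\<omega> \<in> E k. (\<lambda>i. \<omega> (n + k + i)) \<in> A \<inter> ?C} = A \<inter> F k" "{\<omega> \<in> E k. (\<lambda>i. \<omega> (n + k + i)) \<in> ?C} = F k"
      unfolding E_def F_def by auto
  qed
  have step: "emeasure ?P (A \<inter> F k) \<le> c * emeasure ?P (F k)" for k
  proof -
    have C0 [measurable]: "?C \<in> sets paths" and AC: "A \<inter> ?C \<in> sets paths"
      by measurable
    have EP: "\<omega>' \<in> E k" if "\<omega> \<in> E k" "\<omega>' \<in> space paths" "\<And>i. i < n + k \<Longrightarrow> \<omega> i = \<omega>' i" for \<omega> \<omega>'
      using that by (rule E_past)
    have "emeasure ?P (A \<inter> F k) =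
      (\<integral>\<^sup>+\<omega>. indicator (E k) \<omega> * emeasure (chain_law S (return S (\<omega> (n + k))) K) (A \<inter> ?C) \<partial>?P)"
      unfolding shift_E(1)[symmetric] by (rule markov_property[OF \<nu> AC E EP])
    also have "\<dots> \<le> (\<integral>\<^sup>+\<omega>. c * (indicator (E k) \<omega> * emeasure (chain_law S (return S (\<omega> (n + k))) K) ?C) \<partial>?P)"
    proof (intro nn_integral_mono)
      fix \<omega> assume "\<omega> \<in> space ?P"
      then have "\<omega> (n + k) \<in> space S"
        by (auto simp: sp space_PiM)
      from le'[OF this] show "indicator (E k) \<omega> * emeasure (chain_law S (return S (\<omega> (n + k))) K) (A \<inter> ?C)
          \<le> c * (indicator (E k) \<omega> * emeasure (chain_law S (return S (\<omega> (n + k))) K) ?C)"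
        by (auto simp: indicator_def)
    qed
    also have "\<dots> = c * (\<integral>\<^sup>+\<omega>. indicator (E k) \<omega> * emeasure (chain_law S (return S (\<omega> (n + k))) K) ?C \<partial>?P)"
      by (intro nn_integral_cmult) measurable
    also have "(\<integral>\<^sup>+\<omega>. indicator (E k) \<omega> * emeasure (chain_law S (return S (\<omega> (n + k))) K) ?C \<partial>?P) = emeasure ?P (F k)"
      unfolding shift_E(2)[symmetric] by (rule markov_property[OF \<nu> C0 E EP, symmetric])
    finally show ?thesis .
  qed
  have "j = k" if "\<omega> \<in> F j" "\<omega> \<in> F k" for \<omega> j k
    using that by (cases j k rule: linorder_cases) (auto simp: F_def)
  then have disj: "disjoint_family F"
    by (auto simp: disjoint_family_on_def)
  then have disj': "disjoint_family (\<lambda>k. A \<inter> F k)"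
    by (auto simp: disjoint_family_on_def)
  \<comment> \<open>Infinitely many visits guarantee one at or after time \<open>n\<close>, so the
    disjoint \<open>F k\<close> exhaust \<open>D\<close> up to a null set.\<close>
  have "AE \<omega> in ?P. \<omega> \<in> A \<inter> D \<longrightarrow> \<omega> \<in> (\<Union>k. A \<inter> F k)"
    using rec
  proof eventually_elim
    case (elim \<omega>)
    then have "\<exists>k. \<omega> (n + k) \<in> C"
      by (auto simp: infinite_nat_iff_unbounded_le le_iff_add)
    then have "\<exists>k. \<omega> (n + k) \<in> C \<and> (\<forall>j<k. \<omega> (n + j) \<notin> C)"
      by (subst (asm) exists_least_iff) auto
    then show ?case
      by (auto simp: F_def)
  qed
  then have "emeasure ?P (A \<inter> D) \<le> emeasure ?P (\<Union>k. A \<inter> F k)"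
    by (intro emeasure_mono_AE) auto
  also have "\<dots> = (\<Sum>k. emeasure ?P (A \<inter> F k))"
    by (rule suminf_emeasure[symmetric, OF _ disj']) auto
  also have "\<dots> \<le> (\<Sum>k. c * emeasure ?P (F k))"
    by (intro suminf_le step) auto
  also have "\<dots> = c * (\<Sum>k. emeasure ?P (F k))"
    by simp
  also have "(\<Sum>k. emeasure ?P (F k)) = emeasure ?P (\<Union>k. F k)"
    by (rule suminf_emeasure[OF _ disj]) auto
  also have "c * \<dots> \<le> c * emeasure ?P D"
    by (intro mult_left_mono emeasure_mono) (auto simp: F_def)
  finally show ?thesis .
qed

lemma invariant_event_null:
  assumes \<nu>: "\<nu> \<in> space (prob_algebra S)"
    and A: "A \<in> sets paths"
    and inv: "\<And>\<omega>. \<omega> \<in> space paths \<Longrightarrow> (\<lambda>i. \<omega> (Suc i)) \<in> A \<longleftrightarrow> \<omega> \<in> A"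
    and C: "C \<in> sets S"
    and c: "0 \<le> c" "c < 1" and le: "\<And>y. y \<in> C \<Longrightarrow> emeasure (chain_law S (return S y) K) A \<le> ennreal c"
    and rec: "AE \<omega> in chain_law S \<nu> K. infinite {n. \<omega> n \<in> C}"
  shows "measure (chain_law S \<nu> K) A = 0"
proof -
  let ?P = "chain_law S \<nu> K"
  interpret P: prob_space ?P
    by (rule prob_space_chain_law[OF \<nu>])
  note [simp] = sets_chain_law[OF \<nu>]
  \<comment> \<open>One \<open>\<epsilon>\<close> is lost in replacing \<open>A\<close> by
    \<open>A \<inter> D\<close>, another in comparing the probabilities of \<open>D\<close> and
    \<open>A\<close>; the factor \<open>c \<le> 1\<close> on the latter is dropped.\<close>
  have *: "(1 - c) * P.prob A \<le> 2 * \<epsilon>" if "0 < \<epsilon>" for \<epsilon>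
  proof -
    obtain n D where D: "D \<in> past S n" "P.prob (sym_diff A D) < \<epsilon>"
      using past_approximation[OF P.prob_space_axioms sets_chain_law[OF \<nu>] A \<open>0 < \<epsilon>\<close>] by auto
    have [measurable]: "D \<in> sets ?P" "A \<in> sets ?P"
      using past_sets[OF D(1)] A by (auto simp: sets_chain_law[OF \<nu>])
    have "ennreal (P.prob (A \<inter> D)) \<le> ennreal (c * P.prob D)"
      using emeasure_invariant_event_Int_past[OF \<nu> A inv C le rec D(1)] c
      by (simp add: P.emeasure_eq_measure ennreal_mult)
    then have 1: "P.prob (A \<inter> D) \<le> c * P.prob D"
      using c by simp
    have "P.prob A \<le> P.prob ((A \<inter> D) \<union> sym_diff A D)"
      by (intro P.finite_measure_mono) (blast, measurable)
    also have "\<dots> \<le> P.prob (A \<inter> D) + P.prob (sym_diff A D)"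
      by (intro measure_Un_le) measurable
    finally have 2: "P.prob A \<le> P.prob (A \<inter> D) + \<epsilon>"
      using D(2) by simp
    have "P.prob D \<le> P.prob (A \<union> sym_diff A D)"
      by (intro P.finite_measure_mono) (blast, measurable)
    also have "\<dots> \<le> P.prob A + P.prob (sym_diff A D)"
      by (intro measure_Un_le) measurable
    finally have "P.prob D \<le> P.prob A + \<epsilon>"
      using D(2) by simp
    then have "c * P.prob D \<le> c * P.prob A + \<epsilon>"
      using c mult_left_mono[of "P.prob D" "P.prob A + \<epsilon>" c] mult_right_mono[of c 1 \<epsilon>] \<open>0 < \<epsilon>\<close>
      unfolding distrib_left by linarith
    with 1 2 show ?thesis
      by (simp add: left_diff_distrib)
  qed
  have "(1 - c) * P.prob A \<le> 0"
  proof (rule field_le_epsilon)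
    fix e :: real assume "0 < e"
    with *[of "e / 2"] show "(1 - c) * P.prob A \<le> 0 + e"
      by simp
  qed
  then show ?thesis
    using c by (simp add: mult_le_0_iff measure_le_0_iff)
qed

text \<open>Let \<open>V\<close> be the event of infinitely many visits to \<open>A\<close> and
  \<open>q y\<close> its probability from \<open>y\<close>. The complement of \<open>V\<close> is
  invariant and has probability bounded away from \<open>1\<close> wherever \<open>q\<close> is
  bounded away from \<open>0\<close>. Hence \<open>invariant_event_null\<close> applies as soon as
  such a region is visited infinitely often from \<open>x\<close>; the definition grants this if the
  region contains \<open>x\<close> and has positive measure.\<close>

lemma harris_recurrent_AE_infinite_visits:
  assumes irr: "irreducibility_measure S K \<psi>"
    and harris: "\<And>A x. A \<in> sets S \<Longrightarrow> emeasure \<psi> A > 0 \<Longrightarrow> x \<in> A \<Longrightarrow>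
      AE \<omega> in chain_law S (return S x) K. infinite {n. \<omega> n \<in> A}"
    and A [measurable]: "A \<in> sets S" and pos: "emeasure \<psi> A > 0" and x: "x \<in> space S"
  shows "AE \<omega> in chain_law S (return S x) K. infinite {n. \<omega> n \<in> A}"
proof -
  have sets_\<psi> [measurable_cong]: "sets \<psi> = sets S" and \<psi>: "emeasure \<psi> (space S) > 0"
    using irr by (auto simp: irreducibility_measure_def)
  define V where "V = {\<omega> \<in> space paths. \<forall>m. \<exists>n\<ge>m. \<omega> n \<in> A}"
  have V [measurable]: "V \<in> sets paths"
    unfolding V_def by measurable
  have V_iff: "\<omega> \<in> V \<longleftrightarrow> \<omega> \<in> space paths \<and> infinite {n. \<omega> n \<in> A}" for \<omega>
    by (auto simp: V_def infinite_nat_iff_unbounded_le)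
  have inv: "(\<lambda>i. \<omega> (Suc i)) \<in> V \<longleftrightarrow> \<omega> \<in> V" if "\<omega> \<in> space paths" for \<omega>
  proof -
    have "(\<forall>m. \<exists>n\<ge>m. \<omega> (Suc n) \<in> A) \<longleftrightarrow> (\<forall>m. \<exists>n\<ge>m. \<omega> n \<in> A)"
      by (metis Suc_le_D Suc_le_mono le_SucI)
    with that show ?thesis
      by (auto simp: V_def space_PiM)
  qed
  define q where "q y = measure (chain_law S (return S y) K) V" for y
  have q: "emeasure (chain_law S (return S y) K) V = ennreal (q y)" if "y \<in> space S" for y
  proof -
    interpret P: prob_space "chain_law S (return S y) K"
      by (rule prob_space_chain_law) (simp add: that)
    show ?thesis
      by (simp add: q_def P.emeasure_eq_measure)
  qed
  have q_meas [measurable]: "q \<in> borel_measurable S"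
    unfolding q_def by measurable
  have V_A: "emeasure (chain_law S (return S y) K) V = 1" if "y \<in> A" for y
  proof -
    have y: "y \<in> space S"
      using that sets.sets_into_space[OF A] by auto
    interpret P: prob_space "chain_law S (return S y) K"
      by (rule prob_space_chain_law) (simp add: y)
    have "AE \<omega> in chain_law S (return S y) K. \<omega> \<in> V"
      using harris[OF A pos that] AE_space
      by eventually_elim (simp add: V_iff space_chain_law y)
    then show ?thesis
      using y by (intro P.emeasure_eq_1_AE) (auto simp: sets_chain_law)
  qed
  \<comment> \<open>By irreducibility \<open>A\<close> is hit at some fixed time \<open>n\<close>
    with positive probability, and from points of \<open>A\<close> the event \<open>V\<close> is
    almost sure.\<close>
  have q_pos: "0 < q y" if y: "y \<in> space S" for y
  proof -
    let ?P = "chain_law S (return S y) K"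
    note [measurable_cong] = sets_chain_law[OF return_in_prob_algebra[OF y]]
    have sp: "space ?P = space paths"
      using y by (simp add: space_chain_law)
    have "emeasure ?P {\<omega> \<in> space paths. \<exists>n\<ge>1. \<omega> n \<in> A} > 0"
      using irr A pos y by (auto simp: irreducibility_measure_def)
    also have "{\<omega> \<in> space paths. \<exists>n\<ge>1. \<omega> n \<in> A} = (\<Union>n. {\<omega> \<in> space paths. \<omega> (Suc n) \<in> A})"
      by (auto simp: Suc_le_eq gr0_conv_Suc)
    finally have "\<not> (\<forall>n. emeasure ?P {\<omega> \<in> space paths. \<omega> (Suc n) \<in> A} = 0)"
    proof (rule contrapos_pn)
      assume "\<forall>n. emeasure ?P {\<omega> \<in> space paths. \<omega> (Suc n) \<in> A} = 0"
      moreover have "range (\<lambda>n. {\<omega> \<in> space paths. \<omega> (Suc n) \<in> A}) \<subseteq> sets ?P"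
        by (auto simp: sets_chain_law y)
      ultimately show "\<not> emeasure ?P (\<Union>n. {\<omega> \<in> space paths. \<omega> (Suc n) \<in> A}) > 0"
        by (simp add: emeasure_UN_eq_0)
    qed
    then obtain n where "emeasure ?P {\<omega> \<in> space paths. \<omega> n \<in> A} > 0"
      by (auto simp: zero_less_iff_neq_zero)
    also have "emeasure ?P {\<omega> \<in> space paths. \<omega> n \<in> A} = (\<integral>\<^sup>+\<omega>. indicator A (\<omega> n) \<partial>?P)"
    proof -
      have "(\<integral>\<^sup>+\<omega>. indicator A (\<omega> n) \<partial>?P) = (\<integral>\<^sup>+\<omega>. indicator {\<omega> \<in> space paths. \<omega> n \<in> A} \<omega> \<partial>?P)"
        by (intro nn_integral_cong) (simp add: sp indicator_def)
      then show ?thesis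
        by simp
    qed
    \<comment> \<open>The indicator of the whole path space is inserted as the past event, to match
      \<open>markov_property\<close>.\<close>
    also have "\<dots> \<le> (\<integral>\<^sup>+\<omega>. indicator (space paths) \<omega> * emeasure (chain_law S (return S (\<omega> n)) K) V \<partial>?P)"
      by (intro nn_integral_mono) (auto simp: sp V_A indicator_def)
    also have "\<dots> = emeasure ?P {\<omega> \<in> space paths. (\<lambda>i. \<omega> (n + i)) \<in> V}"
      using y by (intro markov_property[symmetric]) auto
    also have "{\<omega> \<in> space paths. (\<lambda>i. \<omega> (n + i)) \<in> V} = V"
      using invariant_shift[OF inv, of _ n] sets.sets_into_space[OF V] by blast
    finally show ?thesis
      by (simp add: q y)
  qed
  \<comment> \<open>As \<open>q\<close> is positive everywhere, these sets increase to the whole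
    space. So \<open>m\<close> can be chosen large enough for \<open>C m\<close> both to have
    positive measure and to contain the given starting point.\<close>
  define C where "C m = {y \<in> space S. q y \<ge> 1 / real (Suc m)}" for m
  have C [measurable]: "C m \<in> sets S" for m
    unfolding C_def by measurable
  have incC: "incseq C"
  proof (rule incseq_SucI)
    fix m
    have "1 / real (Suc (Suc m)) \<le> 1 / real (Suc m)"
      by (intro divide_left_mono) auto
    then show "C m \<subseteq> C (Suc m)"
      unfolding C_def by (auto intro: order_trans)
  qed
  have ex: "\<exists>m. y \<in> C m" if "y \<in> space S" for y
    using reals_Archimedean[OF q_pos[OF that]] that by (auto simp: C_def field_simps intro: less_imp_le)
  have "(SUP m. emeasure \<psi> (C m)) = emeasure \<psi> (\<Union>m. C m)"
    using incC by (intro SUP_emeasure_incseq) auto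
  also have "(\<Union>m. C m) = space S"
    using ex sets.sets_into_space[OF C] by blast
  finally have "0 < (SUP m. emeasure \<psi> (C m))"
    using \<psi> by simp
  then obtain m1 where m1: "emeasure \<psi> (C m1) > 0"
    by (auto simp: less_SUP_iff)
  obtain m2 where m2: "x \<in> C m2"
    using ex[OF x] by blast
  define m where "m = max m1 m2"
  have "emeasure \<psi> (C m1) \<le> emeasure \<psi> (C m)"
    using incC by (intro emeasure_mono) (auto simp: m_def incseq_def)
  with m1 have "emeasure \<psi> (C m) > 0"
    by simp
  moreover have "x \<in> C m"
    using m2 incseqD[OF incC, of m2 m] by (auto simp: m_def)
  ultimately have rec: "AE \<omega> in chain_law S (return S x) K. infinite {n. \<omega> n \<in> C m}"
    by (intro harris) auto
  let ?P = "chain_law S (return S x) K"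
  interpret P: prob_space ?P
    by (rule prob_space_chain_law) (simp add: x)
  note [measurable_cong] = sets_chain_law[OF return_in_prob_algebra[OF x]]
  have sp: "space ?P = space paths"
    using x by (simp add: space_chain_law)
  have "measure ?P (space paths - V) = 0"
  proof (rule invariant_event_null[OF _ _ _ C _ _ _ rec])
    show "(\<lambda>i. \<omega> (Suc i)) \<in> space paths - V \<longleftrightarrow> \<omega> \<in> space paths - V" if "\<omega> \<in> space paths" for \<omega>
      using inv[OF that] that by (auto simp: space_PiM)
    show "1 - 1 / real (Suc m) < 1" "0 \<le> 1 - 1 / real (Suc m)"
      by simp_all
    show "emeasure (chain_law S (return S y) K) (space paths - V) \<le> ennreal (1 - 1 / real (Suc m))" if "y \<in> C m" for y
    proof -
      have y: "y \<in> space S" and qy: "1 / real (Suc m) \<le> q y"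
        using that by (auto simp: C_def)
      interpret Q: prob_space "chain_law S (return S y) K"
        by (rule prob_space_chain_law) (simp add: y)
      have "Q.prob (space paths - V) = 1 - q y"
        using Q.prob_compl[of V] y by (simp add: q_def sets_chain_law space_chain_law)
      with qy show ?thesis
        by (simp add: Q.emeasure_eq_measure)
    qed
  qed (use x in auto)
  then have "space paths - V \<in> null_sets ?P"
    by (intro null_setsI) (simp_all add: P.emeasure_eq_measure sets_chain_law x)
  from AE_not_in[OF this] AE_space show ?thesis
    by eventually_elim (auto simp: sp V_iff)
qed

text \<open>Let \<open>h y\<close> be the probability of \<open>A\<close> from \<open>y\<close>. If
  \<open>h\<close> stays below some \<open>1 - 1 / Suc m\<close> on a set of positive measure, that
  set is visited infinitely often from everywhere and \<open>A\<close> is null. Otherwise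
  \<open>h = 1\<close> holds on a set of positive measure, and the same argument with bound
  \<open>0\<close> shows that the complement of \<open>A\<close> is null.\<close>

lemma harris_zero_one:
  assumes harris: "harris_recurrent S K"
    and A [measurable]: "A \<in> sets paths"
    and inv: "\<And>\<omega>. \<omega> \<in> space paths \<Longrightarrow> (\<lambda>i. \<omega> (Suc i)) \<in> A \<longleftrightarrow> \<omega> \<in> A"
  obtains "\<And>x. x \<in> space S \<Longrightarrow> emeasure (chain_law S (return S x) K) A = 0"
  | "\<And>x. x \<in> space S \<Longrightarrow> emeasure (chain_law S (return S x) K) A = 1"
proof -
  obtain \<psi> where irr: "irreducibility_measure S K \<psi>"
    and rec: "\<forall>A\<in>sets S. emeasure \<psi> A > 0 \<longrightarrow>
      (\<forall>x\<in>A. AE \<omega> in chain_law S (return S x) K. infinite {n. \<omega> n \<in> A})"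
    using harris by (auto simp: harris_recurrent_def maximal_irreducibility_measure_def)
  have visits: "AE \<omega> in chain_law S (return S x) K. infinite {n. \<omega> n \<in> B}"
    if "B \<in> sets S" "emeasure \<psi> B > 0" "x \<in> space S" for B x
    using irr _ that by (rule harris_recurrent_AE_infinite_visits) (use rec in blast)
  have sets_\<psi> [measurable_cong]: "sets \<psi> = sets S" and \<psi>: "emeasure \<psi> (space S) > 0"
    using irr by (auto simp: irreducibility_measure_def)
  define h where "h y = measure (chain_law S (return S y) K) A" for y
  have h: "emeasure (chain_law S (return S y) K) A = ennreal (h y)" if "y \<in> space S" for y
  proof -
    interpret P: prob_space "chain_law S (return S y) K"
      by (rule prob_space_chain_law) (simp add: that)
    show ?thesis
      by (simp add: h_def P.emeasure_eq_measure)
  qed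
  have h_le: "h y \<le> 1" if "y \<in> space S" for y
    using prob_space_chain_law[OF return_in_prob_algebra[OF that]] unfolding h_def
    by (rule prob_space.prob_le_1)
  have h_meas [measurable]: "h \<in> borel_measurable S"
    unfolding h_def by measurable
  define C where "C m = {y \<in> space S. h y \<le> 1 - 1 / real (Suc m)}" for m
  have C [measurable]: "C m \<in> sets S" for m
    unfolding C_def by measurable
  show thesis
  proof (cases "\<exists>m. emeasure \<psi> (C m) > 0")
    case True
    then obtain m where m: "emeasure \<psi> (C m) > 0"
      by blast
    have "measure (chain_law S (return S x) K) A = 0" if x: "x \<in> space S" for x
    proof (rule invariant_event_null[OF _ A inv C _ _ _ visits[OF C m x]])
      show "emeasure (chain_law S (return S y) K) A \<le> ennreal (1 - 1 / real (Suc m))" if "y \<in> C m" for y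
        using that by (auto simp: C_def h intro!: ennreal_leI)
    qed (use x in auto)
    then show thesis
      by (intro that(1)) (simp add: h h_def)
  next
    case False
    let ?D = "{y \<in> space S. h y = 1}"
    have D [measurable]: "?D \<in> sets S"
      by measurable
    have "emeasure \<psi> (\<Union>m. C m) = 0"
      using False by (intro emeasure_UN_eq_0) auto
    moreover have "space S = (\<Union>m. C m) \<union> ?D"
    proof (intro equalityI subsetI)
      fix y assume y: "y \<in> space S"
      show "y \<in> (\<Union>m. C m) \<union> ?D"
      proof (cases "h y = 1")
        case False
        with h_le[OF y] have "0 < 1 - h y"
          by simp
        from reals_Archimedean[OF this] obtain m where "inverse (real (Suc m)) < 1 - h y" ..
        with y have "y \<in> C m"
          by (simp add: C_def inverse_eq_divide)
        then show ?thesis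
          by blast
      qed (use y in simp)
    qed (auto simp: C_def)
    ultimately have "emeasure \<psi> (space S) \<le> 0 + emeasure \<psi> ?D"
      using emeasure_subadditive[of "\<Union>m. C m" \<psi> ?D] by auto
    with \<psi> have D_pos: "emeasure \<psi> ?D > 0"
      by (simp add: less_le_trans)
    have compl: "measure (chain_law S (return S y) K) (space paths - A) = 1 - h y" if y: "y \<in> space S" for y
    proof -
      interpret Q: prob_space "chain_law S (return S y) K"
        by (rule prob_space_chain_law) (simp add: y)
      show ?thesis
        using Q.prob_compl[of A] y by (simp add: h_def sets_chain_law space_chain_law)
    qed
    have "measure (chain_law S (return S x) K) (space paths - A) = 0" if x: "x \<in> space S" for x
    proof (rule invariant_event_null[OF _ _ _ D _ _ _ visits[OF D D_pos x]])
      show "(\<lambda>i. \<omega> (Suc i)) \<in> space paths - A \<longleftrightarrow> \<omega> \<in> space paths - A" if "\<omega> \<in> space paths" for \<omega>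
        using inv[OF that] that by (auto simp: space_PiM)
      show "emeasure (chain_law S (return S y) K) (space paths - A) \<le> ennreal 0" if "y \<in> ?D" for y
      proof -
        have y: "y \<in> space S"
          using that by simp
        interpret Q: prob_space "chain_law S (return S y) K"
          by (rule prob_space_chain_law) (simp add: y)
        show ?thesis
          using compl[OF y] that by (simp add: Q.emeasure_eq_measure)
      qed
    qed (use x in auto)
    then show thesis
      by (intro that(2)) (simp add: h compl)
  qed
qed

end

section \<open>Law of large numbers for positive Harris chains\<close>

text \<open>Garsia's proof: \<open>m n\<close> is the maximum of \<open>0\<close> and the first \<open>n\<close> partial sums along the orbit.\<close>

lemma maximal_ergodic:
  fixes F :: "'w \<Rightarrow> real"
  assumes T [measurable]: "T \<in> M \<rightarrow>\<^sub>M M" and pres: "distr M M T = M" and F [measurable]: "integrable M F"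
    and pos: "AE \<omega> in M. \<exists>n. 0 < (\<Sum>i<n. F ((T ^^ i) \<omega>))"
  shows "0 \<le> (\<integral>\<omega>. F \<omega> \<partial>M)"
proof -
  \<comment> \<open>The running maximum is given by its recursion along \<open>T\<close>, because
    this recursion is what the comparison with \<open>F\<close> below uses.\<close>
  define m where "m = rec_nat (\<lambda>_. 0) (\<lambda>n g \<omega>. max 0 (F \<omega> + g (T \<omega>)))"
  have m0: "m 0 = (\<lambda>_. 0)" and mSuc: "m (Suc n) = (\<lambda>\<omega>. max 0 (F \<omega> + m n (T \<omega>)))" for n
    by (simp_all add: m_def)
  have nonneg: "0 \<le> m n \<omega>" for n \<omega>
    by (cases n) (simp_all add: m0 mSuc)
  have mono: "m n \<omega> \<le> m (Suc n) \<omega>" for n \<omega>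
  proof (induction n arbitrary: \<omega>)
    case (Suc n)
    have "m (Suc n) \<omega> = max 0 (F \<omega> + m n (T \<omega>))"
      by (simp add: mSuc)
    also have "\<dots> \<le> max 0 (F \<omega> + m (Suc n) (T \<omega>))"
      using Suc.IH[of "T \<omega>"] by (intro max.mono) auto
    also have "\<dots> = m (Suc (Suc n)) \<omega>"
      by (simp add: mSuc)
    finally show ?case .
  qed (simp add: m0 nonneg)
  then have mono': "m n \<omega> \<le> m k \<omega>" if "n \<le> k" for n k \<omega>
    using that by (rule lift_Suc_mono_le)
  have sum_le: "(\<Sum>i<n. F ((T ^^ i) \<omega>)) \<le> m n \<omega>" for n \<omega>
  proof (induction n arbitrary: \<omega>)
    case (Suc n)
    then show ?case
      using add_left_mono[OF Suc.IH[of "T \<omega>"], of "F \<omega>"] by (simp add: le_max_iff_disj sum.lessThan_Suc_shift mSuc funpow_swap1 del: sum.lessThan_Suc)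
  qed (simp add: m0)
  have int_T: "integrable M (\<lambda>\<omega>. g (T \<omega>))" "(\<integral>\<omega>. g (T \<omega>) \<partial>M) = (\<integral>\<omega>. g \<omega> \<partial>M)" if "integrable M g" for g :: "'w \<Rightarrow> real"
  proof -
    have "integrable (distr M M T) g"
      using that by (simp add: pres)
    then show "integrable M (\<lambda>\<omega>. g (T \<omega>))"
      by (rule integrable_distr[OF T])
    have "(\<integral>\<omega>. g \<omega> \<partial>distr M M T) = (\<integral>\<omega>. g (T \<omega>) \<partial>M)"
      using that by (intro integral_distr) auto
    then show "(\<integral>\<omega>. g (T \<omega>) \<partial>M) = (\<integral>\<omega>. g \<omega> \<partial>M)"
      by (simp add: pres)
  qed
  have m_int: "integrable M (m n)" for n
  proof (induction n)
    case (Suc n)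
    then show ?case
      unfolding mSuc using F int_T(1) by (intro integrable_max) auto
  qed (simp add: m0)
  note [measurable] = borel_measurable_integrable[OF m_int] borel_measurable_integrable[OF F]
  define f where "f n \<omega> = F \<omega> * indicator {\<omega>. 0 < m n \<omega>} \<omega>" for n \<omega>
  have f_meas [measurable]: "f n \<in> borel_measurable M" for n
    unfolding f_def indicator_def by measurable
  have f_int: "integrable M (f n)" for n
    by (rule Bochner_Integration.integrable_bound[OF F]) (auto simp: f_def indicator_def)
  \<comment> \<open>Invariance replaces the integral of \<open>m n\<close> by that of
    \<open>m n\<close> after \<open>T\<close>. Where \<open>m (Suc n)\<close> is positive, its
    excess over \<open>m n\<close> after \<open>T\<close> equals \<open>F\<close> by the recursion;
    elsewhere the excess is at most \<open>0\<close>.\<close>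
  have f_nonneg: "0 \<le> (\<integral>\<omega>. f (Suc n) \<omega> \<partial>M)" for n
  proof -
    have "0 \<le> (\<integral>\<omega>. m (Suc n) \<omega> \<partial>M) - (\<integral>\<omega>. m n \<omega> \<partial>M)"
      using integral_mono[OF m_int m_int mono, of n] by simp
    also have "\<dots> = (\<integral>\<omega>. m (Suc n) \<omega> - m n (T \<omega>) \<partial>M)"
      using int_T[OF m_int] m_int by simp
    also have "\<dots> \<le> (\<integral>\<omega>. f (Suc n) \<omega> \<partial>M)"
    proof (rule integral_mono)
      show "m (Suc n) \<omega> - m n (T \<omega>) \<le> f (Suc n) \<omega>" for \<omega>
        using nonneg[of n "T \<omega>"] by (auto simp: f_def mSuc indicator_def)
    qed (use int_T[OF m_int] m_int f_int in auto)
    finally show ?thesis .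
  qed
  \<comment> \<open>Almost every orbit has a positive partial sum, so the indicator in
    \<open>f\<close> is eventually \<open>1\<close> there, and \<open>F\<close> itself supplies the
    dominating function.\<close>
  have "(\<lambda>n. \<integral>\<omega>. f n \<omega> \<partial>M) \<longlonglongrightarrow> (\<integral>\<omega>. F \<omega> \<partial>M)"
  proof (rule integral_dominated_convergence[where w="\<lambda>\<omega>. \<bar>F \<omega>\<bar>"])
    show "AE \<omega> in M. (\<lambda>n. f n \<omega>) \<longlonglongrightarrow> F \<omega>"
      using pos
    proof eventually_elim
      case (elim \<omega>)
      then obtain n where "0 < (\<Sum>i<n. F ((T ^^ i) \<omega>))" ..
      then have "0 < m k \<omega>" if "n \<le> k" for k
        using sum_le[of \<omega> n] mono'[OF that, of \<omega>] by linarith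
      then have "\<forall>\<^sub>F k in sequentially. f k \<omega> = F \<omega>"
        by (auto simp: eventually_sequentially f_def intro!: exI[of _ n])
      then show ?case
        by (rule tendsto_eventually)
    qed
    show "AE \<omega> in M. norm (f n \<omega>) \<le> \<bar>F \<omega>\<bar>" for n
      by (auto simp: f_def indicator_def)
  qed (use F in auto)
  then have "(\<lambda>n. \<integral>\<omega>. f (Suc n) \<omega> \<partial>M) \<longlonglongrightarrow> (\<integral>\<omega>. F \<omega> \<partial>M)"
    by (rule LIMSEQ_Suc)
  then show ?thesis
    by (rule LIMSEQ_le_const) (use f_nonneg in auto)
qed

text \<open>For accuracy \<open>r\<close>, the slope error \<open>1 / Suc k\<close> is made smaller
  than \<open>r / 2\<close>, and the constants divided by \<open>n\<close> fall below
  \<open>r / 2\<close> for large \<open>n\<close>. Taking \<open>n \<ge> Suc N\<close> also keeps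
  \<open>n\<close> positive for the division.\<close>

lemma average_convergence_criterion:
  fixes s :: "nat \<Rightarrow> real"
  assumes upper: "\<And>k. \<exists>c. \<forall>n. s n \<le> c + real n * (\<mu> + 1 / real (Suc k))"
    and lower: "\<And>k. \<exists>c. \<forall>n. - s n \<le> c + real n * (- \<mu> + 1 / real (Suc k))"
  shows "(\<lambda>n. s n / real n) \<longlonglongrightarrow> \<mu>"
proof (rule LIMSEQ_I)
  fix r :: real assume "0 < r"
  then obtain k where k: "1 / real (Suc k) < r / 2"
    using reals_Archimedean[of "r / 2"] by (auto simp: inverse_eq_divide)
  obtain c d where c: "\<And>n. s n \<le> c + real n * (\<mu> + 1 / real (Suc k))"
    and d: "\<And>n. - s n \<le> d + real n * (- \<mu> + 1 / real (Suc k))"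
    using upper[of k] lower[of k] by blast
  obtain N where N: "max c d * 2 / r < real N"
    using reals_Archimedean2 by blast
  have "norm (s n / real n - \<mu>) < r" if n: "n \<ge> Suc N" for n
  proof -
    have "max c d * 2 / r < real n"
      using N n by linarith
    then have "max c d < real n * (r / 2)"
      using \<open>0 < r\<close> by (simp add: field_simps)
    moreover have "real n * (1 / real (Suc k)) < real n * (r / 2)"
      using k n by (intro mult_strict_left_mono) auto
    moreover have "real n * (r / 2) + real n * (r / 2) = real n * r"
      by simp
    ultimately have "s n < real n * (\<mu> + r)" "- s n < real n * (- \<mu> + r)"
      using c[of n] d[of n] unfolding distrib_left by linarith+
    then have "s n / real n < \<mu> + r" "\<mu> - r < s n / real n"
      using n by (auto simp: field_simps)
    then show ?thesis
      by (simp add: abs_less_iff)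
  qed
  then show "\<exists>no. \<forall>n\<ge>no. norm (s n / real n - \<mu>) < r"
    by blast
qed

section \<open>Partial sums along a Harris chain\<close>

context markov_kernel
begin

lemma distr_chain_law_0:
  assumes \<nu>: "\<nu> \<in> space (prob_algebra S)"
  shows "distr (chain_law S \<nu> K) S (\<lambda>\<omega>. \<omega> 0) = \<nu>"
proof (rule measure_eqI)
  note [measurable_cong] = sets_chain_law[OF \<nu>]
  show "sets (distr (chain_law S \<nu> K) S (\<lambda>\<omega>. \<omega> 0)) = sets \<nu>"
    using \<nu> by (simp add: space_prob_algebra)
  have sp: "space \<nu> = space S"
    using \<nu> by (auto simp: space_prob_algebra intro!: sets_eq_imp_space_eq)
  fix A assume "A \<in> sets (distr (chain_law S \<nu> K) S (\<lambda>\<omega>. \<omega> 0))"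
  then have A [measurable]: "A \<in> sets S"
    by simp
  have "emeasure (distr (chain_law S \<nu> K) S (\<lambda>\<omega>. \<omega> 0)) A = emeasure (chain_law S \<nu> K) {\<omega> \<in> space paths. \<omega> 0 \<in> A}"
    by (subst emeasure_distr) (auto simp: space_chain_law \<nu> vimage_def Int_def conj_commute)
  also have "\<dots> = (\<integral>\<^sup>+x. emeasure (chain_law S (return S x) K) {\<omega> \<in> space paths. \<omega> 0 \<in> A} \<partial>\<nu>)"
    by (rule emeasure_chain_law[OF \<nu>]) measurable
  also have "\<dots> = (\<integral>\<^sup>+x. indicator A x \<partial>\<nu>)"
    by (intro nn_integral_cong) (simp add: emeasure_chain_law_0 sp)
  also have "\<dots> = emeasure \<nu> A"
    using \<nu> A by (simp add: space_prob_algebra)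
  finally show "emeasure (distr (chain_law S \<nu> K) S (\<lambda>\<omega>. \<omega> 0)) A = emeasure \<nu> A" .
qed

text \<open>Dropping the first term shifts all later partial sums by the fixed number
  \<open>g (\<omega> 0) - b\<close>, which does not affect unboundedness. Thresholds range over the
  naturals, so the event is built from countable operations.\<close>

lemma unbounded_partial_sums_event:
  fixes b :: real
  assumes g [measurable]: "g \<in> borel_measurable S"
  defines "B \<equiv> {\<omega> \<in> space paths. \<forall>c. \<exists>n. real c < (\<Sum>i<n. g (\<omega> i) - b)}"
  shows "B \<in> sets paths"
    and "\<omega> \<in> space paths \<Longrightarrow> (\<lambda>i. \<omega> (Suc i)) \<in> B \<longleftrightarrow> \<omega> \<in> B"
proof -
  show "B \<in> sets paths"
    unfolding B_def by measurable
  assume \<omega>: "\<omega> \<in> space paths"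
  let ?s = "\<lambda>\<omega> n. \<Sum>i<n. g (\<omega> i) - b" and ?\<omega>' = "\<lambda>i. \<omega> (Suc i)"
  have shift: "?s \<omega> (Suc n) = (g (\<omega> 0) - b) + ?s ?\<omega>' n" for n
    by (rule sum.lessThan_Suc_shift)
  have *: "(\<forall>c. \<exists>n. real c < ?s ?\<omega>' n) \<longleftrightarrow> (\<forall>c. \<exists>n. real c < ?s \<omega> n)"
  proof (intro iffI allI)
    fix c assume *: "\<forall>c. \<exists>n. real c < ?s ?\<omega>' n"
    obtain c' where c': "real c - (g (\<omega> 0) - b) < real c'"
      using reals_Archimedean2 by blast
    with * obtain n where "real c' < ?s ?\<omega>' n"
      by blast
    with c' shift[of n] have "real c < ?s \<omega> (Suc n)"
      by linarith
    then show "\<exists>n. real c < ?s \<omega> n"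
      by blast
  next
    fix c assume *: "\<forall>c. \<exists>n. real c < ?s \<omega> n"
    obtain c' where c': "real c + (g (\<omega> 0) - b) < real c'"
      using reals_Archimedean2 by blast
    with * obtain n where n: "real c' < ?s \<omega> n"
      by blast
    \<comment> \<open>The threshold \<open>real c'\<close> is nonnegative, so the empty sum cannot
      exceed it.\<close>
    then have "n \<noteq> 0"
      by (cases n) auto
    then obtain k where "n = Suc k"
      using not0_implies_Suc by blast
    with n have "real c' < (g (\<omega> 0) - b) + ?s ?\<omega>' k"
      unfolding shift[symmetric] by simp
    with c' have "real c < ?s ?\<omega>' k"
      by linarith
    then show "\<exists>n. real c < ?s ?\<omega>' n"
      by blast
  qed
  have "?\<omega>' \<in> space paths"
    using \<omega> by (auto simp: space_PiM)
  with * \<omega> show "?\<omega>' \<in> B \<longleftrightarrow> \<omega> \<in> B"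
    unfolding B_def by simp
qed

lemma harris_partial_sums_bounded_above:
  assumes harris: "harris_recurrent S K" and inv: "invariant_probability S K \<rho>"
    and g: "integrable \<rho> g" and b: "(\<integral>x. g x \<partial>\<rho>) < b" and \<nu>: "\<nu> \<in> space (prob_algebra S)"
  shows "AE \<omega> in chain_law S \<nu> K. \<exists>c. \<forall>n. (\<Sum>i<n. g (\<omega> i)) \<le> c + real n * b"
proof -
  have \<rho>: "\<rho> \<in> space (prob_algebra S)" and [measurable_cong]: "sets \<rho> = sets S"
    using inv by (auto simp: invariant_probability_def space_prob_algebra)
  interpret \<rho>: prob_space \<rho>
    using inv by (simp add: invariant_probability_def)
  note [measurable_cong] = sets_chain_law[OF \<nu>] sets_chain_law[OF \<rho>]
  have g_meas [measurable]: "g \<in> borel_measurable S"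
    using borel_measurable_integrable[OF g] by measurable
  define B where "B = {\<omega> \<in> space paths. \<forall>c. \<exists>n. real c < (\<Sum>i<n. g (\<omega> i) - b)}"
  have B [measurable]: "B \<in> sets paths"
    and B_inv: "\<And>\<omega>. \<omega> \<in> space paths \<Longrightarrow> (\<lambda>i. \<omega> (Suc i)) \<in> B \<longleftrightarrow> \<omega> \<in> B"
    unfolding B_def using unbounded_partial_sums_event[OF g_meas, where b = b] by auto
  have null: "emeasure (chain_law S (return S x) K) B = 0" if "x \<in> space S" for x
    using harris B B_inv
  proof (rule harris_zero_one)
    assume one: "\<And>x. x \<in> space S \<Longrightarrow> emeasure (chain_law S (return S x) K) B = 1"
    let ?P = "chain_law S \<rho> K" and ?T = "\<lambda>(\<omega> :: nat \<Rightarrow> 's) i. \<omega> (Suc i)"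
    interpret P: prob_space ?P
      by (rule prob_space_chain_law[OF \<rho>])
    have "emeasure ?P B = (\<integral>\<^sup>+x. 1 \<partial>\<rho>)"
      unfolding emeasure_chain_law[OF \<rho> B] using sets_eq_imp_space_eq[OF \<open>sets \<rho> = sets S\<close>]
      by (intro nn_integral_cong one) simp
    then have "AE \<omega> in ?P. \<omega> \<in> B"
      by (intro P.AE_in_set_eq_1[THEN iffD2]) (simp_all add: \<rho>.emeasure_space_1 P.emeasure_eq_measure)
    have pow: "(?T ^^ i) \<omega> = (\<lambda>j. \<omega> (i + j))" for i \<omega>
      by (induction i arbitrary: \<omega>) (simp_all add: fun_eq_iff)
    have g0: "integrable ?P (\<lambda>\<omega>. g (\<omega> 0))"
      by (rule integrable_distr[of _ _ S]) (simp_all add: distr_chain_law_0[OF \<rho>] g)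
    have "(\<integral>\<omega>. g (\<omega> 0) \<partial>?P) = (\<integral>x. g x \<partial>distr ?P S (\<lambda>\<omega>. \<omega> 0))"
      by (rule integral_distr[symmetric]) measurable
    then have g0': "(\<integral>\<omega>. g (\<omega> 0) \<partial>?P) = (\<integral>x. g x \<partial>\<rho>)"
      by (simp add: distr_chain_law_0[OF \<rho>])
    have "0 \<le> (\<integral>\<omega>. g (\<omega> 0) - b \<partial>?P)"
    proof (rule maximal_ergodic[where T = ?T])
      show "?T \<in> ?P \<rightarrow>\<^sub>M ?P"
        by measurable
      show "distr ?P ?P ?T = ?P"
        using distr_chain_law_shift[OF inv] by (simp cong: distr_cong add: sets_chain_law[OF \<rho>])
      show "integrable ?P (\<lambda>\<omega>. g (\<omega> 0) - b)"
        using g0 by simp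
      \<comment> \<open>Membership in \<open>B\<close> at threshold \<open>0\<close> supplies the
        positive partial sum.\<close>
      show "AE \<omega> in ?P. \<exists>n. 0 < (\<Sum>i<n. g ((?T ^^ i) \<omega> 0) - b)"
        using \<open>AE \<omega> in ?P. \<omega> \<in> B\<close>
        by eventually_elim (auto simp: B_def pow dest!: spec[of _ 0])
    qed
    then have "b \<le> (\<integral>x. g x \<partial>\<rho>)"
      using g0 g0' by (simp add: P.prob_space)
    with b show ?thesis
      by simp
  next
    assume "\<And>x. x \<in> space S \<Longrightarrow> emeasure (chain_law S (return S x) K) B = 0"
    with that show ?thesis
      by blast
  qed
  have "emeasure (chain_law S \<nu> K) B = (\<integral>\<^sup>+x. 0 \<partial>\<nu>)"
    unfolding emeasure_chain_law[OF \<nu> B] using \<nu> sets_eq_imp_space_eq[of \<nu> S]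
    by (intro nn_integral_cong null) (simp add: space_prob_algebra)
  then have "B \<in> null_sets (chain_law S \<nu> K)"
    by (simp add: null_sets_def sets_chain_law[OF \<nu>])
  from AE_not_in[OF this] AE_space show ?thesis
  proof eventually_elim
    case (elim \<omega>)
    then obtain c where "\<And>n. (\<Sum>i<n. g (\<omega> i) - b) \<le> real c"
      by (auto simp: B_def space_chain_law[OF \<nu>] not_less)
    then have "(\<Sum>i<n. g (\<omega> i)) \<le> real c + real n * b" for n
      by (simp add: sum_subtractf algebra_simps)
    then show ?case
      by blast
  qed
qed

text \<open>The exceptional null set of the linear bound depends on its slope; using only the slopes
  with error \<open>1 / Suc k\<close> leaves countably many null sets.\<close>

theorem harris_law_of_large_numbers:
  assumes harris: "harris_recurrent S K" and inv: "invariant_probability S K \<rho>"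
    and g: "integrable \<rho> g" and \<nu>: "\<nu> \<in> space (prob_algebra S)"
  shows "AE \<omega> in chain_law S \<nu> K. (\<lambda>n. (\<Sum>i<n. g (\<omega> i)) / real n) \<longlonglongrightarrow> (\<integral>x. g x \<partial>\<rho>)"
proof -
  let ?\<mu> = "\<integral>x. g x \<partial>\<rho>"
  have "AE \<omega> in chain_law S \<nu> K. \<forall>k. \<exists>c. \<forall>n. (\<Sum>i<n. g (\<omega> i)) \<le> c + real n * (?\<mu> + 1 / real (Suc k))"
    unfolding AE_all_countable using harris inv g _ \<nu>
    by (rule harris_partial_sums_bounded_above[THEN allI]) simp
  moreover have "AE \<omega> in chain_law S \<nu> K. \<forall>k. \<exists>c. \<forall>n. (\<Sum>i<n. - g (\<omega> i)) \<le> c + real n * (- ?\<mu> + 1 / real (Suc k))"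
    unfolding AE_all_countable
  proof
    fix k
    have "(\<integral>x. - g x \<partial>\<rho>) < - ?\<mu> + 1 / real (Suc k)"
      by simp
    then show "AE \<omega> in chain_law S \<nu> K. \<exists>c. \<forall>n. (\<Sum>i<n. - g (\<omega> i)) \<le> c + real n * (- ?\<mu> + 1 / real (Suc k))"
      by (intro harris_partial_sums_bounded_above[OF harris inv _ _ \<nu>]) (simp_all add: g)
  qed
  ultimately show ?thesis
    by eventually_elim (rule average_convergence_criterion, auto simp: sum_negf)
qed

end

section \<open>The invariant law of multiple-proposal Metropolis-Hastings\<close>

lemma space_points: "space (points \<Omega> n) = {1..n} \<rightarrow>\<^sub>E \<Omega>"
  by (simp add: points_def space_PiM space_restrict_space)

lemma omit_put:
  assumes J: "J \<in> {1..N + 1}" and z: "z \<in> extensional {1..N}"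
  shows "omit N J (put N J x z) = z"
proof
  fix j show "omit N J (put N J x z) j = z j"
    using J z by (cases "j \<in> {1..N}") (auto simp: omit_def put_def extensional_def)
qed

lemma put_same: "J \<in> {1..N + 1} \<Longrightarrow> put N J x z J = x"
  by (simp add: put_def)

locale multiple_proposals =
  fixes \<Omega> :: "'a::euclidean_space set" and \<pi> :: "'a \<Rightarrow> real" and \<kappa> :: "'a \<Rightarrow> (nat \<Rightarrow> 'a) \<Rightarrow> real"
    and N M :: nat and p :: "(nat \<Rightarrow> 'a) \<Rightarrow> nat \<Rightarrow> real"
  assumes \<Omega>: "\<Omega> \<in> sets borel" and M: "1 \<le> M"
    and target: "is_target \<Omega> \<pi>"
    and proposal: "is_proposal_kernel \<Omega> N \<kappa>"
    and selection: "is_selection_probability \<Omega> \<pi> \<kappa> N p"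
begin

abbreviation L :: "'a measure" where "L \<equiv> restrict_space lborel \<Omega>"
abbreviation indices :: "(nat \<Rightarrow> nat) measure" where "indices \<equiv> Pi\<^sub>M {1..M} (\<lambda>_. count_space {1..N + 1})"

sublocale L: sigma_finite_measure L
  using \<Omega> lborel.sigma_finite_measure_axioms by (intro sigma_finite_measure_restrict_space) auto

sublocale points: product_sigma_finite "\<lambda>_ :: nat. L"
  by (rule product_sigma_finite.intro) (rule L.sigma_finite_measure_axioms)

sublocale indices: product_sigma_finite "\<lambda>_ :: nat. count_space {1..N + 1}"
  by (rule product_sigma_finite.intro) (simp add: sigma_finite_measure_count_space_finite)

lemma sigma_finite_points: "sigma_finite_measure (points \<Omega> n)"
  unfolding points_def by (rule points.sigma_finite) simp

lemma sigma_finite_indices: "sigma_finite_measure indices"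
  by (rule indices.sigma_finite) simp

lemma space_L [simp]: "space L = \<Omega>"
  by (simp add: space_restrict_space)

lemma measurable_coordinate [measurable (raw)]: "j \<in> {1..n} \<Longrightarrow> (\<lambda>y. y j) \<in> points \<Omega> n \<rightarrow>\<^sub>M L"
  unfolding points_def by (rule measurable_component_singleton)

lemma measurable_put:
  assumes J: "J \<in> {1..N + 1}"
  shows "(\<lambda>(x, z). put N J x z) \<in> L \<Otimes>\<^sub>M points \<Omega> N \<rightarrow>\<^sub>M points \<Omega> (N + 1)"
  unfolding points_def[of _ "N + 1"] put_def case_prod_unfold
proof (rule measurable_restrict)
  fix j assume j: "j \<in> {1..N + 1}"
  have c: "(\<lambda>x. snd x i) \<in> L \<Otimes>\<^sub>M points \<Omega> N \<rightarrow>\<^sub>M L" if "i \<in> {1..N}" for i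
    using measurable_coordinate[OF that] by measurable
  consider "j < J" "j \<in> {1..N}" | "j = J" | "J < j" "j - 1 \<in> {1..N}"
    using j J by force
  then show "(\<lambda>x. if j < J then snd x j else if j = J then fst x else snd x (j - 1)) \<in> L \<Otimes>\<^sub>M points \<Omega> N \<rightarrow>\<^sub>M L"
    by cases (simp_all add: c)
qed

lemma measurable_put' [measurable (raw)]:
  "J \<in> {1..N + 1} \<Longrightarrow> f \<in> X \<rightarrow>\<^sub>M L \<Longrightarrow> g \<in> X \<rightarrow>\<^sub>M points \<Omega> N \<Longrightarrow>
    (\<lambda>x. put N J (f x) (g x)) \<in> X \<rightarrow>\<^sub>M points \<Omega> (N + 1)"
  using measurable_compose[OF measurable_Pair measurable_put, of f X g J] by simp

lemma measurable_omit [measurable (raw)]: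
  assumes J: "J \<in> {1..N + 1}"
  shows "omit N J \<in> points \<Omega> (N + 1) \<rightarrow>\<^sub>M points \<Omega> N"
  unfolding points_def[of _ N] omit_def
proof (rule measurable_restrict)
  fix j assume j: "j \<in> {1..N}"
  show "(\<lambda>y. if j < J then y j else y (j + 1)) \<in> points \<Omega> (N + 1) \<rightarrow>\<^sub>M L"
    using j by (cases "j < J") (auto intro!: measurable_coordinate)
qed

text \<open>Insertion only relabels coordinates, so it carries the product of the Lebesgue measures
  to itself; on boxes this is a reindexing of a finite product.\<close>

lemma distr_put:
  assumes J: "J \<in> {1..N + 1}"
  shows "distr (L \<Otimes>\<^sub>M points \<Omega> N) (points \<Omega> (N + 1)) (\<lambda>(x, z). put N J x z) = points \<Omega> (N + 1)"
  unfolding points_def[of _ "N + 1"]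
proof (rule points.PiM_eqI)
  fix A assume A: "\<And>i. i \<in> {1..N + 1} \<Longrightarrow> A i \<in> sets L"
  interpret Z: sigma_finite_measure "points \<Omega> N"
    by (rule sigma_finite_points)
  \<comment> \<open>\<open>e\<close> is the increasing enumeration of all positions except
    \<open>J\<close>: entry \<open>j\<close> of the proposal vector lands at position
    \<open>e j\<close>.\<close>
  define e where "e j = (if j < J then j else j + 1)" for j
  let ?B = "Pi\<^sub>E {1..N} (\<lambda>j. A (e j))"
  have e: "e j \<in> {1..N + 1}" "e j \<noteq> J" if "j \<in> {1..N}" for j
    using that by (auto simp: e_def)
  have inj: "inj_on e {1..N}"
    by (auto simp: inj_on_def e_def split: if_splits)
  have range: "{1..N + 1} = insert J (e ` {1..N})"
  proof -
    have "i \<in> insert J (e ` {1..N})" if i: "i \<in> {1..N + 1}" for i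
    proof -
      consider "i = J" | "i < J" "i \<in> {1..N}" | "J < i" "i - 1 \<in> {1..N}"
        using i J by force
      then show ?thesis
      proof cases
        case 2
        then have "i = e i"
          by (simp add: e_def)
        with 2 show ?thesis
          by blast
      next
        case 3
        then have "i = e (i - 1)"
          by (auto simp: e_def)
        with 3 show ?thesis
          by blast
      qed simp
    qed
    then have "{1..N + 1} \<subseteq> insert J (e ` {1..N})"
      by blast
    moreover have "insert J (e ` {1..N}) \<subseteq> {1..N + 1}"
      using J e(1) by blast
    ultimately show ?thesis
      by (rule equalityI)
  qed
  have sub: "A i \<subseteq> \<Omega>" if "i \<in> {1..N + 1}" for i
    using sets.sets_into_space[OF A[OF that]] by simp
  have B: "?B \<in> sets (points \<Omega> N)"
    unfolding points_def using A e(1) by (intro sets_PiM_I_finite) auto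
  have AB: "put N J x z \<in> Pi\<^sub>E {1..N + 1} A \<longleftrightarrow> x \<in> A J \<and> (\<forall>j\<in>{1..N}. z j \<in> A (e j))" for x z
  proof -
    have put_e: "put N J x z (e j) = z j" if "j \<in> {1..N}" for j
      using that by (auto simp: put_def e_def)
    have "put N J x z \<in> Pi\<^sub>E {1..N + 1} A \<longleftrightarrow> (\<forall>i\<in>{1..N + 1}. put N J x z i \<in> A i)"
      by (auto simp: PiE_iff put_def)
    also have "\<dots> \<longleftrightarrow> x \<in> A J \<and> (\<forall>j\<in>{1..N}. put N J x z (e j) \<in> A (e j))"
      unfolding range by (simp add: put_same[OF J] del: atLeastAtMost_iff)
    finally show ?thesis
      using put_e by simp
  qed
  have "emeasure (distr (L \<Otimes>\<^sub>M points \<Omega> N) (Pi\<^sub>M {1..N + 1} (\<lambda>_. L)) (\<lambda>(x, z). put N J x z)) (Pi\<^sub>E {1..N + 1} A) =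
    emeasure (L \<Otimes>\<^sub>M points \<Omega> N) ((\<lambda>(x, z). put N J x z) -` Pi\<^sub>E {1..N + 1} A \<inter> space (L \<Otimes>\<^sub>M points \<Omega> N))"
    using A measurable_put[OF J] unfolding points_def[of _ "N + 1"] by (intro emeasure_distr sets_PiM_I_finite) auto
  also have "(\<lambda>(x, z). put N J x z) -` Pi\<^sub>E {1..N + 1} A \<inter> space (L \<Otimes>\<^sub>M points \<Omega> N) = A J \<times> ?B"
  proof (intro set_eqI)
    fix xz :: "'a \<times> (nat \<Rightarrow> 'a)"
    obtain x z where xz: "xz = (x, z)"
      by (rule prod.exhaust)
    have "z \<in> space (points \<Omega> N) \<and> (\<forall>j\<in>{1..N}. z j \<in> A (e j)) \<longleftrightarrow> z \<in> ?B"
      unfolding space_points PiE_iff using sub[OF e(1)] by blast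
    moreover have "x \<in> \<Omega> \<and> x \<in> A J \<longleftrightarrow> x \<in> A J"
      using sub[OF J] by blast
    ultimately show "xz \<in> (\<lambda>(x, z). put N J x z) -` Pi\<^sub>E {1..N + 1} A \<inter> space (L \<Otimes>\<^sub>M points \<Omega> N) \<longleftrightarrow> xz \<in> A J \<times> ?B"
      unfolding xz vimage_eq Int_iff prod.case AB space_pair_measure mem_Sigma_iff space_L by blast
  qed
  also have "emeasure (L \<Otimes>\<^sub>M points \<Omega> N) (A J \<times> ?B) = emeasure L (A J) * emeasure (points \<Omega> N) ?B"
    using A J B by (intro Z.emeasure_pair_measure_Times) auto
  also have "emeasure (points \<Omega> N) ?B = (\<Prod>j\<in>{1..N}. emeasure L (A (e j)))"
    unfolding points_def using A e(1) by (intro points.emeasure_PiM) auto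
  also have "emeasure L (A J) * \<dots> = (\<Prod>i\<in>insert J (e ` {1..N}). emeasure L (A i))"
  proof -
    have "J \<notin> e ` {1..N}"
      using e(2) by blast
    with inj show ?thesis
      by (subst prod.insert) (simp_all add: prod.reindex)
  qed
  also have "insert J (e ` {1..N}) = {1..N + 1}"
    by (rule range[symmetric])
  finally show "emeasure (distr (L \<Otimes>\<^sub>M points \<Omega> N) (Pi\<^sub>M {1..N + 1} (\<lambda>_. L)) (\<lambda>(x, z). put N J x z)) (Pi\<^sub>E {1..N + 1} A) =
      (\<Prod>i\<in>{1..N + 1}. emeasure L (A i))" .
qed simp_all

lemma nn_integral_put:
  assumes J: "J \<in> {1..N + 1}" and F [measurable]: "F \<in> borel_measurable (points \<Omega> (N + 1))"
  shows "(\<integral>\<^sup>+x. \<integral>\<^sup>+z. F (put N J x z) \<partial>points \<Omega> N \<partial>L) = (\<integral>\<^sup>+y. F y \<partial>points \<Omega> (N + 1))"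
proof -
  interpret Z: sigma_finite_measure "points \<Omega> N"
    by (rule sigma_finite_points)
  note [measurable] = measurable_put[OF J]
  have "(\<integral>\<^sup>+y. F y \<partial>points \<Omega> (N + 1)) = (\<integral>\<^sup>+xz. F (case xz of (x, z) \<Rightarrow> put N J x z) \<partial>(L \<Otimes>\<^sub>M points \<Omega> N))"
    by (subst distr_put[OF J, symmetric], subst nn_integral_distr) measurable
  also have "\<dots> = (\<integral>\<^sup>+x. \<integral>\<^sup>+z. F (put N J x z) \<partial>points \<Omega> N \<partial>L)"
    by (subst Z.nn_integral_fst[symmetric]) measurable
  finally show ?thesis ..
qed

section \<open>Target, proposal and selection densities\<close>

lemma \<pi>_measurable [measurable]: "\<pi> \<in> borel_measurable L"
  and \<pi>_nonneg: "x \<in> \<Omega> \<Longrightarrow> 0 \<le> \<pi> x"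
  and \<pi>_integral: "(\<integral>\<^sup>+x. ennreal (\<pi> x) \<partial>L) = 1"
  using target by (auto simp: is_target_def)

lemma \<kappa>_measurable: "(\<lambda>(x, z). \<kappa> x z) \<in> borel_measurable (L \<Otimes>\<^sub>M points \<Omega> N)"
  and \<kappa>_nonneg: "x \<in> \<Omega> \<Longrightarrow> z \<in> space (points \<Omega> N) \<Longrightarrow> 0 \<le> \<kappa> x z"
  and \<kappa>_integral: "x \<in> \<Omega> \<Longrightarrow> (\<integral>\<^sup>+z. ennreal (\<kappa> x z) \<partial>points \<Omega> N) = 1"
  using proposal by (auto simp: is_proposal_kernel_def)

lemma \<kappa>_measurable' [measurable (raw)]:
  "f \<in> X \<rightarrow>\<^sub>M L \<Longrightarrow> g \<in> X \<rightarrow>\<^sub>M points \<Omega> N \<Longrightarrow> (\<lambda>x. \<kappa> (f x) (g x)) \<in> borel_measurable X"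
  using measurable_compose[OF measurable_Pair \<kappa>_measurable, of f X g] by simp

lemma p_measurable: "i \<in> {1..N + 1} \<Longrightarrow> (\<lambda>y. p y i) \<in> borel_measurable (points \<Omega> (N + 1))"
  by (rule selection[unfolded is_selection_probability_def, THEN conjunct1, THEN bspec])

text \<open>The numerator of the selection probability; up to the factor \<open>1 / (N + 1)\<close>
  it is the joint density of the points and the index \<open>j\<close>.\<close>

definition weight :: "nat \<Rightarrow> (nat \<Rightarrow> 'a) \<Rightarrow> real" where
  "weight j y = \<pi> (y j) * \<kappa> (y j) (omit N j y)"

lemma p_nonneg: "y \<in> space (points \<Omega> (N + 1)) \<Longrightarrow> i \<in> {1..N + 1} \<Longrightarrow> 0 \<le> p y i"
  and p_sum: "y \<in> space (points \<Omega> (N + 1)) \<Longrightarrow> (\<Sum>i=1..N + 1. p y i) = 1"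
  and p_eq: "y \<in> space (points \<Omega> (N + 1)) \<Longrightarrow> (\<Sum>j=1..N+1. weight j y) \<noteq> 0 \<Longrightarrow> i \<in> {1..N + 1} \<Longrightarrow>
    p y i = weight i y / (\<Sum>j=1..N+1. weight j y)"
proof -
  assume y: "y \<in> space (points \<Omega> (N + 1))"
  note * = selection[unfolded is_selection_probability_def, folded weight_def, THEN conjunct2, THEN bspec, OF y]
  show "i \<in> {1..N + 1} \<Longrightarrow> 0 \<le> p y i"
    by (rule *[THEN conjunct1, THEN bspec])
  show "(\<Sum>i=1..N + 1. p y i) = 1"
    by (rule *[THEN conjunct2, THEN conjunct1])
  show "(\<Sum>j=1..N+1. weight j y) \<noteq> 0 \<Longrightarrow> i \<in> {1..N + 1} \<Longrightarrow> p y i = weight i y / (\<Sum>j=1..N+1. weight j y)"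
    by (rule *[THEN conjunct2, THEN conjunct2, THEN mp, THEN bspec])
qed

lemma p_measurable' [measurable (raw)]:
  assumes "f \<in> X \<rightarrow>\<^sub>M points \<Omega> (N + 1)" "g \<in> X \<rightarrow>\<^sub>M count_space {1..N + 1}"
  shows "(\<lambda>x. p (f x) (g x)) \<in> borel_measurable X"
proof (rule measurable_compose_countable'[where f = "\<lambda>i x. p (f x) i", OF _ assms(2)])
  show "(\<lambda>x. p (f x) i) \<in> borel_measurable X" if "i \<in> {1..N + 1}" for i
    by (rule measurable_compose[OF assms(1) p_measurable[OF that]])
qed simp

lemma coordinate_measurable [measurable (raw)]:
  assumes "f \<in> X \<rightarrow>\<^sub>M points \<Omega> n" "g \<in> X \<rightarrow>\<^sub>M count_space {1..n}"
  shows "(\<lambda>x. f x (g x)) \<in> X \<rightarrow>\<^sub>M L"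
proof (rule measurable_compose_countable'[where f = "\<lambda>i x. f x i", OF _ assms(2)])
  show "(\<lambda>x. f x i) \<in> X \<rightarrow>\<^sub>M L" if "i \<in> {1..n}" for i
    by (rule measurable_compose[OF assms(1) measurable_coordinate[OF that]])
qed simp

lemma index_measurable [measurable (raw)]:
  "f \<in> X \<rightarrow>\<^sub>M indices \<Longrightarrow> m \<in> {1..M} \<Longrightarrow> (\<lambda>x. f x m) \<in> X \<rightarrow>\<^sub>M count_space {1..N + 1}"
  by (rule measurable_compose[OF _ measurable_component_singleton])

text \<open>The integrand is a product over the \<open>M\<close> independent indices, with
  \<open>h\<close> attached to the factor \<open>k\<close> only; the other factors sum to
  \<open>1\<close>.\<close>

lemma nn_integral_indices:
  assumes y: "y \<in> space (points \<Omega> (N + 1))" and k: "k \<in> {1..M}"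
  shows "(\<integral>\<^sup>+I. ennreal (\<Prod>m=1..M. p y (I m)) * h (I k) \<partial>indices) = (\<Sum>i=1..N + 1. ennreal (p y i) * h i)"
proof -
  have sum1: "(\<Sum>i=1..N + 1. ennreal (p y i)) = 1"
    using p_sum[OF y] by (subst sum_ennreal) (auto intro: p_nonneg[OF y])
  have "(\<integral>\<^sup>+I. ennreal (\<Prod>m=1..M. p y (I m)) * h (I k) \<partial>indices) =
    (\<integral>\<^sup>+I. (\<Prod>m\<in>{1..M}. ennreal (p y (I m)) * (if m = k then h (I m) else 1)) \<partial>indices)"
  proof (intro nn_integral_cong)
    fix I assume I: "I \<in> space indices"
    have "ennreal (\<Prod>m=1..M. p y (I m)) = (\<Prod>m=1..M. ennreal (p y (I m)))"
      using I by (intro prod_ennreal[symmetric] p_nonneg[OF y]) (auto simp: space_PiM PiE_iff)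
    moreover have "(\<Prod>m=1..M. if m = k then h (I m) else 1) = h (I k)"
      using k by (simp add: prod.delta)
    ultimately show "ennreal (\<Prod>m=1..M. p y (I m)) * h (I k) =
        (\<Prod>m\<in>{1..M}. ennreal (p y (I m)) * (if m = k then h (I m) else 1))"
      by (simp add: prod.distrib)
  qed
  also have "\<dots> = (\<Prod>m\<in>{1..M}. \<integral>\<^sup>+i. ennreal (p y i) * (if m = k then h i else 1) \<partial>count_space {1..N + 1})"
    by (intro indices.product_nn_integral_prod[where f = "\<lambda>m i. ennreal (p y i) * (if m = k then h i else 1)"]) auto
  also have "\<dots> = (\<Prod>m\<in>{1..M}. if m = k then (\<Sum>i=1..N + 1. ennreal (p y i) * h i) else 1)"
    using sum1 by (intro prod.cong refl) (simp add: nn_integral_count_space_finite)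
  also have "\<dots> = (\<Sum>i=1..N + 1. ennreal (p y i) * h i)"
    using k by (simp add: prod.delta)
  finally show ?thesis .
qed

lemma accepted_measurable [measurable]: "accepted M \<in> outcomes \<Omega> N M \<rightarrow>\<^sub>M points \<Omega> M"
  unfolding accepted_def outcomes_def points_def[of _ M] case_prod_unfold
  by (rule measurable_restrict) measurable

section \<open>The law of one iteration\<close>

lemma nn_integral_iteration:
  assumes x: "x \<in> \<Omega>" and J: "J \<in> {1..N + 1}" and G [measurable]: "G \<in> borel_measurable (outcomes \<Omega> N M)"
  shows "(\<integral>\<^sup>+\<omega>. G \<omega> \<partial>iteration \<Omega> \<kappa> p N M x J) =
    (\<integral>\<^sup>+(z, I). ennreal (\<kappa> x z * (\<Prod>m=1..M. p (put N J x z) (I m))) * G (put N J x z, I) \<partial>(points \<Omega> N \<Otimes>\<^sub>M indices))"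
proof -
  have [measurable]: "x \<in> space L"
    using x by simp
  let ?T = "\<lambda>(z, I). (put N J x z, I)" and ?D = "\<lambda>(z, I). ennreal (\<kappa> x z * (\<Prod>m=1..M. p (put N J x z) (I m)))"
  have T [measurable]: "?T \<in> points \<Omega> N \<Otimes>\<^sub>M indices \<rightarrow>\<^sub>M outcomes \<Omega> N M"
    unfolding outcomes_def using J by measurable
  have D [measurable]: "?D \<in> borel_measurable (points \<Omega> N \<Otimes>\<^sub>M indices)"
    using J by measurable
  have "(\<integral>\<^sup>+\<omega>. G \<omega> \<partial>iteration \<Omega> \<kappa> p N M x J) = (\<integral>\<^sup>+zI. G (?T zI) \<partial>density (points \<Omega> N \<Otimes>\<^sub>M indices) ?D)"
    unfolding iteration_def by (rule nn_integral_distr) measurable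
  also have "\<dots> = (\<integral>\<^sup>+zI. ?D zI * G (?T zI) \<partial>(points \<Omega> N \<Otimes>\<^sub>M indices))"
    by (rule nn_integral_density) measurable
  finally show ?thesis
    by (simp add: case_prod_unfold)
qed

text \<open>Fubini separates proposals from indices, and given the proposals
  \<open>nn_integral_indices\<close> sums out all indices but the \<open>k\<close>-th. With constant
  \<open>\<phi>\<close> this computes the total mass, with general \<open>\<phi>\<close> the law of
  one accepted sample.\<close>

lemma nn_integral_iteration_selected:
  assumes x: "x \<in> \<Omega>" and J: "J \<in> {1..N + 1}" and k: "k \<in> {1..M}" and \<phi> [measurable]: "\<phi> \<in> borel_measurable L"
  shows "(\<integral>\<^sup>+(y, I). \<phi> (y (I k)) \<partial>iteration \<Omega> \<kappa> p N M x J) =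
    (\<integral>\<^sup>+z. ennreal (\<kappa> x z) * (\<Sum>i=1..N + 1. ennreal (p (put N J x z) i) * \<phi> (put N J x z i)) \<partial>points \<Omega> N)"
proof -
  interpret I: sigma_finite_measure indices
    by (rule sigma_finite_indices)
  have [measurable]: "x \<in> space L"
    using x by simp
  have G: "(\<lambda>(y, I). \<phi> (y (I k))) \<in> borel_measurable (outcomes \<Omega> N M)"
    unfolding outcomes_def using k by measurable
  have "(\<integral>\<^sup>+(y, I). \<phi> (y (I k)) \<partial>iteration \<Omega> \<kappa> p N M x J) =
    (\<integral>\<^sup>+(z, I). ennreal (\<kappa> x z * (\<Prod>m=1..M. p (put N J x z) (I m))) * \<phi> (put N J x z (I k)) \<partial>(points \<Omega> N \<Otimes>\<^sub>M indices))"
    (is "_ = (\<integral>\<^sup>+zI. ?F zI \<partial>_)")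
    unfolding nn_integral_iteration[OF x J G] by (simp add: case_prod_unfold)
  also have "\<dots> = (\<integral>\<^sup>+z. \<integral>\<^sup>+I. ?F (z, I) \<partial>indices \<partial>points \<Omega> N)"
  proof (rule I.nn_integral_fst[symmetric])
    show "?F \<in> borel_measurable (points \<Omega> N \<Otimes>\<^sub>M indices)"
      using J k by measurable
  qed
  also have "\<dots> = (\<integral>\<^sup>+z. \<integral>\<^sup>+I. ennreal (\<kappa> x z * (\<Prod>m=1..M. p (put N J x z) (I m))) * \<phi> (put N J x z (I k)) \<partial>indices \<partial>points \<Omega> N)"
    by simp
  also have "\<dots> = (\<integral>\<^sup>+z. ennreal (\<kappa> x z) * (\<Sum>i=1..N + 1. ennreal (p (put N J x z) i) * \<phi> (put N J x z i)) \<partial>points \<Omega> N)"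
  proof (intro nn_integral_cong)
    fix z assume z [measurable]: "z \<in> space (points \<Omega> N)"
    have y: "put N J x z \<in> space (points \<Omega> (N + 1))"
      using measurable_space[OF measurable_put[OF J], of "(x, z)"] x z by (simp add: space_pair_measure)
    have "(\<integral>\<^sup>+I. ennreal (\<kappa> x z * (\<Prod>m=1..M. p (put N J x z) (I m))) * \<phi> (put N J x z (I k)) \<partial>indices) =
      (\<integral>\<^sup>+I. ennreal (\<kappa> x z) * (ennreal (\<Prod>m=1..M. p (put N J x z) (I m)) * \<phi> (put N J x z (I k))) \<partial>indices)"
      using \<kappa>_nonneg[OF x z]
      by (intro nn_integral_cong, subst ennreal_mult)
         (auto intro!: prod_nonneg p_nonneg[OF y] simp: space_PiM PiE_iff mult.assoc)
    also have "\<dots> = ennreal (\<kappa> x z) * (\<integral>\<^sup>+I. ennreal (\<Prod>m=1..M. p (put N J x z) (I m)) * \<phi> (put N J x z (I k)) \<partial>indices)"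
      using J k by (intro nn_integral_cmult) measurable
    finally show "(\<integral>\<^sup>+I. ennreal (\<kappa> x z * (\<Prod>m=1..M. p (put N J x z) (I m))) * \<phi> (put N J x z (I k)) \<partial>indices) =
        ennreal (\<kappa> x z) * (\<Sum>i=1..N + 1. ennreal (p (put N J x z) i) * \<phi> (put N J x z i))"
      using nn_integral_indices[OF y k, of "\<lambda>i. \<phi> (put N J x z i)"] by simp
  qed
  finally show ?thesis .
qed

lemma prob_space_iteration:
  assumes x: "x \<in> \<Omega>" and J: "J \<in> {1..N + 1}"
  shows "prob_space (iteration \<Omega> \<kappa> p N M x J)"
proof (rule prob_spaceI)
  have "emeasure (iteration \<Omega> \<kappa> p N M x J) (space (iteration \<Omega> \<kappa> p N M x J)) =
    (\<integral>\<^sup>+(y, I). 1 \<partial>iteration \<Omega> \<kappa> p N M x J)"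
    by (simp add: case_prod_unfold)
  \<comment> \<open>The constant function \<open>1\<close> is evaluated at the last selected index,
    which exists because \<open>1 \<le> M\<close>.\<close>
  also have "\<dots> = (\<integral>\<^sup>+z. ennreal (\<kappa> x z) * (\<Sum>i=1..N + 1. ennreal (p (put N J x z) i) * 1) \<partial>points \<Omega> N)"
    using nn_integral_iteration_selected[OF x J, of M "\<lambda>_. 1"] M by simp
  also have "\<dots> = (\<integral>\<^sup>+z. ennreal (\<kappa> x z) \<partial>points \<Omega> N)"
  proof (intro nn_integral_cong)
    fix z assume z: "z \<in> space (points \<Omega> N)"
    have y: "put N J x z \<in> space (points \<Omega> (N + 1))"
      using measurable_space[OF measurable_put[OF J], of "(x, z)"] x z by (simp add: space_pair_measure)
    have "(\<Sum>i=1..N + 1. ennreal (p (put N J x z) i)) = 1"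
      using p_sum[OF y] by (subst sum_ennreal) (auto intro: p_nonneg[OF y])
    then show "ennreal (\<kappa> x z) * (\<Sum>i=1..N + 1. ennreal (p (put N J x z) i) * 1) = ennreal (\<kappa> x z)"
      by simp
  qed
  also have "\<dots> = 1"
    by (rule \<kappa>_integral[OF x])
  finally show "emeasure (iteration \<Omega> \<kappa> p N M x J) (space (iteration \<Omega> \<kappa> p N M x J)) = 1" .
qed

lemma sets_iteration [simp]: "sets (iteration \<Omega> \<kappa> p N M x J) = sets (outcomes \<Omega> N M)"
  by (simp add: iteration_def)

lemma measurable_iteration:
  assumes J: "J \<in> {1..N + 1}"
  shows "(\<lambda>x. iteration \<Omega> \<kappa> p N M x J) \<in> L \<rightarrow>\<^sub>M prob_algebra (outcomes \<Omega> N M)"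
proof (intro measurable_prob_algebraI measurable_subprob_algebra)
  fix A assume A [measurable]: "A \<in> sets (outcomes \<Omega> N M)"
  interpret ZI: sigma_finite_measure "points \<Omega> N \<Otimes>\<^sub>M indices"
    by (intro sigma_finite_pair_measure sigma_finite_points sigma_finite_indices)
  have T [measurable]: "(\<lambda>(x, z, I). (put N J x z, I)) \<in> L \<Otimes>\<^sub>M (points \<Omega> N \<Otimes>\<^sub>M indices) \<rightarrow>\<^sub>M outcomes \<Omega> N M"
    unfolding outcomes_def using J by measurable
  have "(\<lambda>x. \<integral>\<^sup>+(z, I). ennreal (\<kappa> x z * (\<Prod>m=1..M. p (put N J x z) (I m))) * indicator A (put N J x z, I)
      \<partial>(points \<Omega> N \<Otimes>\<^sub>M indices)) \<in> borel_measurable L"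
  proof (rule ZI.borel_measurable_nn_integral)
    have [measurable]: "(\<lambda>xzI. indicator A ((\<lambda>(x, z, I). (put N J x z, I)) xzI) :: ennreal) \<in> borel_measurable (L \<Otimes>\<^sub>M (points \<Omega> N \<Otimes>\<^sub>M indices))"
      by (rule measurable_compose[OF T]) simp
    have [measurable]: "(\<lambda>(x, z, I). ennreal (\<kappa> x z * (\<Prod>m=1..M. p (put N J x z) (I m)))) \<in> borel_measurable (L \<Otimes>\<^sub>M (points \<Omega> N \<Otimes>\<^sub>M indices))"
      using J by measurable
    have "(\<lambda>xzI. (\<lambda>(x, z, I). ennreal (\<kappa> x z * (\<Prod>m=1..M. p (put N J x z) (I m)))) xzI * indicator A ((\<lambda>(x, z, I). (put N J x z, I)) xzI))
        \<in> borel_measurable (L \<Otimes>\<^sub>M (points \<Omega> N \<Otimes>\<^sub>M indices))"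
      by measurable
    then show "(\<lambda>(x, z, I). ennreal (\<kappa> x z * (\<Prod>m=1..M. p (put N J x z) (I m))) * indicator A (put N J x z, I))
        \<in> borel_measurable (L \<Otimes>\<^sub>M (points \<Omega> N \<Otimes>\<^sub>M indices))"
      by (simp add: case_prod_unfold)
  qed
  moreover have "emeasure (iteration \<Omega> \<kappa> p N M x J) A = (\<integral>\<^sup>+(z, I). ennreal (\<kappa> x z * (\<Prod>m=1..M. p (put N J x z) (I m))) *
      indicator A (put N J x z, I) \<partial>(points \<Omega> N \<Otimes>\<^sub>M indices))" if "x \<in> \<Omega>" for x
    using nn_integral_iteration[OF that J, of "indicator A"] by simp
  ultimately show "(\<lambda>x. emeasure (iteration \<Omega> \<kappa> p N M x J) A) \<in> borel_measurable L"
    by (subst measurable_cong) simp_all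
qed (auto intro!: prob_space_imp_subprob_space prob_space_iteration J)

text \<open>The kept index takes finitely many values, so measurability for each fixed index
  suffices.\<close>

lemma measurable_step:
  "(\<lambda>(y, I). iteration \<Omega> \<kappa> p N M (y (I M)) (I M)) \<in> outcomes \<Omega> N M \<rightarrow>\<^sub>M prob_algebra (outcomes \<Omega> N M)"
proof -
  have M_mem: "M \<in> {1..M}"
    using M by simp
  have g: "(\<lambda>\<omega>. snd \<omega> M) \<in> outcomes \<Omega> N M \<rightarrow>\<^sub>M count_space {1..N + 1}"
    unfolding outcomes_def using M_mem by measurable
  have f: "(\<lambda>\<omega>. fst \<omega> j) \<in> outcomes \<Omega> N M \<rightarrow>\<^sub>M L" if "j \<in> {1..N + 1}" for j
    unfolding outcomes_def by (rule measurable_compose[OF measurable_fst measurable_coordinate[OF that]])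
  have "(\<lambda>\<omega>. iteration \<Omega> \<kappa> p N M (fst \<omega> (snd \<omega> M)) (snd \<omega> M)) \<in> outcomes \<Omega> N M \<rightarrow>\<^sub>M prob_algebra (outcomes \<Omega> N M)"
    by (rule measurable_compose_countable'[where f = "\<lambda>j \<omega>. iteration \<Omega> \<kappa> p N M (fst \<omega> j) j", OF measurable_compose[OF f measurable_iteration] g]) auto
  then show ?thesis
    by (simp add: case_prod_unfold)
qed

text \<open>The joint density of points and selected index is preserved: \<open>p y i\<close> times the total weight
  is the weight of \<open>i\<close>, also where the total weight vanishes.\<close>

lemma sum_nn_integral_selected:
  assumes k: "k \<in> {1..M}" and \<phi> [measurable]: "\<phi> \<in> borel_measurable L"
  shows "(\<Sum>J=1..N + 1. \<integral>\<^sup>+x. ennreal (\<pi> x) * (\<integral>\<^sup>+(y, I). \<phi> (y (I k)) \<partial>iteration \<Omega> \<kappa> p N M x J) \<partial>L) =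
    (\<Sum>J=1..N + 1. \<integral>\<^sup>+x. ennreal (\<pi> x) * \<phi> x \<partial>L)"
proof -
  define q where "q y = (\<Sum>i=1..N + 1. ennreal (p y i) * \<phi> (y i))" for y
  have p_meas [measurable]: "(\<lambda>y. p y i) \<in> borel_measurable (points \<Omega> (N + 1))" if "i \<in> {1..N + 1}" for i
    using that by (rule p_measurable)
  have \<phi>_meas [measurable]: "(\<lambda>y. \<phi> (y i)) \<in> borel_measurable (points \<Omega> (N + 1))" if "i \<in> {1..N + 1}" for i
    using that by measurable
  have w_meas [measurable]: "weight i \<in> borel_measurable (points \<Omega> (N + 1))" if "i \<in> {1..N + 1}" for i
    unfolding weight_def using that by measurable
  have q_meas [measurable]: "q \<in> borel_measurable (points \<Omega> (N + 1))"
    unfolding q_def by measurable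
  have put: "put N J x z \<in> space (points \<Omega> (N + 1))" if "J \<in> {1..N + 1}" "x \<in> \<Omega>" "z \<in> space (points \<Omega> N)" for J x z
    using measurable_space[OF measurable_put[OF that(1)], of "(x, z)"] that by (simp add: space_pair_measure)
  have weight_put: "weight J (put N J x z) = \<pi> x * \<kappa> x z" if "J \<in> {1..N + 1}" "z \<in> space (points \<Omega> N)" for J x z
    using that unfolding weight_def put_same[OF that(1)]
    by (subst omit_put) (auto simp: space_points PiE_iff)
  have weight_nonneg: "0 \<le> weight i y" if "i \<in> {1..N + 1}" "y \<in> space (points \<Omega> (N + 1))" for i y
  proof -
    have "y i \<in> \<Omega>" "omit N i y \<in> space (points \<Omega> N)"
      using measurable_space[OF measurable_coordinate[OF that(1)] that(2)] measurable_space[OF measurable_omit[OF that(1)] that(2)] by simp_all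
    then show ?thesis
      by (simp add: weight_def \<pi>_nonneg \<kappa>_nonneg)
  qed
  \<comment> \<open>Integrating against \<open>weight J\<close> amounts to drawing the
    \<open>J\<close>-th point from the target and the remaining ones from its proposal
    density.\<close>
  have change: "(\<integral>\<^sup>+y. ennreal (weight J y) * h y \<partial>points \<Omega> (N + 1)) =
      (\<integral>\<^sup>+x. ennreal (\<pi> x) * (\<integral>\<^sup>+z. ennreal (\<kappa> x z) * h (put N J x z) \<partial>points \<Omega> N) \<partial>L)"
    if J: "J \<in> {1..N + 1}" and h [measurable]: "h \<in> borel_measurable (points \<Omega> (N + 1))" for J h
  proof -
    have [measurable]: "weight J \<in> borel_measurable (points \<Omega> (N + 1))"
      by (rule w_meas[OF J])
    have wh: "(\<lambda>y. ennreal (weight J y) * h y) \<in> borel_measurable (points \<Omega> (N + 1))"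
      by measurable
    have "(\<integral>\<^sup>+y. ennreal (weight J y) * h y \<partial>points \<Omega> (N + 1)) =
      (\<integral>\<^sup>+x. \<integral>\<^sup>+z. ennreal (weight J (put N J x z)) * h (put N J x z) \<partial>points \<Omega> N \<partial>L)"
      by (rule nn_integral_put[OF J wh, symmetric])
    also have "\<dots> = (\<integral>\<^sup>+x. ennreal (\<pi> x) * (\<integral>\<^sup>+z. ennreal (\<kappa> x z) * h (put N J x z) \<partial>points \<Omega> N) \<partial>L)"
    proof (intro nn_integral_cong)
      fix x assume x [measurable]: "x \<in> space L"
      have "(\<integral>\<^sup>+z. ennreal (weight J (put N J x z)) * h (put N J x z) \<partial>points \<Omega> N) =
        (\<integral>\<^sup>+z. ennreal (\<pi> x) * (ennreal (\<kappa> x z) * h (put N J x z)) \<partial>points \<Omega> N)"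
        using x J by (intro nn_integral_cong) (simp add: weight_put ennreal_mult \<pi>_nonneg \<kappa>_nonneg mult.assoc del: atLeastAtMost_iff)
      also have "\<dots> = ennreal (\<pi> x) * (\<integral>\<^sup>+z. ennreal (\<kappa> x z) * h (put N J x z) \<partial>points \<Omega> N)"
        using J by (intro nn_integral_cmult) measurable
      finally show "(\<integral>\<^sup>+z. ennreal (weight J (put N J x z)) * h (put N J x z) \<partial>points \<Omega> N) =
          ennreal (\<pi> x) * (\<integral>\<^sup>+z. ennreal (\<kappa> x z) * h (put N J x z) \<partial>points \<Omega> N)" .
    qed
    finally show ?thesis .
  qed
  have bayes: "(\<Sum>J=1..N + 1. ennreal (weight J y)) * ennreal (p y i) = ennreal (weight i y)"
    if y: "y \<in> space (points \<Omega> (N + 1))" and i: "i \<in> {1..N + 1}" for y i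
  proof -
    have w: "0 \<le> weight J y" if "J \<in> {1..N + 1}" for J
      using that y by (rule weight_nonneg)
    have "(\<Sum>J=1..N + 1. weight J y) * p y i = weight i y"
    proof (cases "(\<Sum>J=1..N + 1. weight J y) = 0")
      case True
      \<comment> \<open>Nonnegative weights with zero sum all vanish, so the free choice of
        \<open>p y\<close> there does no harm.\<close>
      then have "weight i y = 0"
        using sum_nonneg_eq_0_iff[of "{1..N + 1}" "\<lambda>J. weight J y"] w i by blast
      with True show ?thesis
        by (simp only: mult_zero_left)
    next
      case False
      then show ?thesis
        unfolding p_eq[OF y False i] times_divide_eq_right by (rule nonzero_mult_div_cancel_left)
    qed
    moreover have "(\<Sum>J=1..N + 1. ennreal (weight J y)) = ennreal (\<Sum>J=1..N + 1. weight J y)"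
      using w by (rule sum_ennreal)
    ultimately show ?thesis
      using w p_nonneg[OF y i] by (metis ennreal_mult sum_nonneg)
  qed
  \<comment> \<open>On full vectors \<open>y\<close>, summing over the kept position
    \<open>J\<close> produces the total weight; multiplying by \<open>p y i\<close> turns it into
    the weight of the selected position \<open>i\<close>, and changing variables back at
    \<open>i\<close> recovers the target.\<close>
  have "(\<Sum>J=1..N + 1. \<integral>\<^sup>+x. ennreal (\<pi> x) * (\<integral>\<^sup>+(y, I). \<phi> (y (I k)) \<partial>iteration \<Omega> \<kappa> p N M x J) \<partial>L) =
    (\<Sum>J=1..N + 1. \<integral>\<^sup>+y. ennreal (weight J y) * q y \<partial>points \<Omega> (N + 1))"
  proof (intro sum.cong refl)
    fix J assume J: "J \<in> {1..N + 1}"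
    show "(\<integral>\<^sup>+x. ennreal (\<pi> x) * (\<integral>\<^sup>+(y, I). \<phi> (y (I k)) \<partial>iteration \<Omega> \<kappa> p N M x J) \<partial>L) =
      (\<integral>\<^sup>+y. ennreal (weight J y) * q y \<partial>points \<Omega> (N + 1))"
      unfolding change[OF J q_meas]
    proof (intro nn_integral_cong arg_cong2[where f = "(*)"] refl)
      fix x assume "x \<in> space L"
      then have "x \<in> \<Omega>"
        by simp
      from nn_integral_iteration_selected[OF this J k \<phi>]
      show "(\<integral>\<^sup>+(y, I). \<phi> (y (I k)) \<partial>iteration \<Omega> \<kappa> p N M x J) =
          (\<integral>\<^sup>+z. ennreal (\<kappa> x z) * q (put N J x z) \<partial>points \<Omega> N)"
        unfolding q_def .
    qed
  qed
  also have "\<dots> = (\<integral>\<^sup>+y. (\<Sum>J=1..N + 1. ennreal (weight J y) * q y) \<partial>points \<Omega> (N + 1))"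
    by (intro nn_integral_sum[symmetric]) measurable
  also have "\<dots> = (\<integral>\<^sup>+y. (\<Sum>i=1..N + 1. ennreal (weight i y) * \<phi> (y i)) \<partial>points \<Omega> (N + 1))"
  proof (intro nn_integral_cong)
    fix y assume y: "y \<in> space (points \<Omega> (N + 1))"
    have "(\<Sum>J=1..N + 1. ennreal (weight J y) * q y) = (\<Sum>J=1..N + 1. ennreal (weight J y)) * q y"
      by (rule sum_distrib_right[symmetric])
    also have "\<dots> = (\<Sum>i=1..N + 1. (\<Sum>J=1..N + 1. ennreal (weight J y)) * ennreal (p y i) * \<phi> (y i))"
      unfolding q_def sum_distrib_left mult.assoc ..
    also have "\<dots> = (\<Sum>i=1..N + 1. ennreal (weight i y) * \<phi> (y i))"
      by (intro sum.cong refl arg_cong2[where f = "(*)"] bayes y)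
    finally show "(\<Sum>J=1..N + 1. ennreal (weight J y) * q y) = (\<Sum>i=1..N + 1. ennreal (weight i y) * \<phi> (y i))" .
  qed
  also have "\<dots> = (\<Sum>i=1..N + 1. \<integral>\<^sup>+y. ennreal (weight i y) * \<phi> (y i) \<partial>points \<Omega> (N + 1))"
    by (intro nn_integral_sum) measurable
  also have "\<dots> = (\<Sum>i=1..N + 1. \<integral>\<^sup>+x. ennreal (\<pi> x) * \<phi> x \<partial>L)"
  proof (intro sum.cong refl)
    fix i assume i: "i \<in> {1..N + 1}"
    show "(\<integral>\<^sup>+y. ennreal (weight i y) * \<phi> (y i) \<partial>points \<Omega> (N + 1)) = (\<integral>\<^sup>+x. ennreal (\<pi> x) * \<phi> x \<partial>L)"
      unfolding change[OF i \<phi>_meas[OF i]] put_same[OF i]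
    proof (intro nn_integral_cong arg_cong2[where f = "(*)"] refl)
      fix x assume x [measurable]: "x \<in> space L"
      have "(\<integral>\<^sup>+z. ennreal (\<kappa> x z) * \<phi> x \<partial>points \<Omega> N) = (\<integral>\<^sup>+z. ennreal (\<kappa> x z) \<partial>points \<Omega> N) * \<phi> x"
        by (rule nn_integral_multc) measurable
      then show "(\<integral>\<^sup>+z. ennreal (\<kappa> x z) * \<phi> x \<partial>points \<Omega> N) = \<phi> x"
        using \<kappa>_integral[of x] x by simp
    qed
  qed
  finally show ?thesis .
qed

end

section \<open>The chain of accepted samples and its stationary law\<close>

locale multiple_proposals_chain = multiple_proposals +
  fixes K :: "(nat \<Rightarrow> 'a) \<Rightarrow> (nat \<Rightarrow> 'a) measure"
  assumes kernel: "K \<in> points \<Omega> M \<rightarrow>\<^sub>M prob_algebra (points \<Omega> M)"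
    and accepted: "accepted_samples_kernel \<Omega> \<kappa> p N M K"
begin

sublocale markov_kernel "points \<Omega> M" K
  by (rule markov_kernel.intro) (rule kernel)

text \<open>A measurable choice of a state whose last coordinate is \<open>x\<close>. The value of
  \<open>K\<close> depends on the last coordinate only, so \<open>K (const_point x)\<close> is the
  transition law out of \<open>x\<close>.\<close>

definition const_point :: "'a \<Rightarrow> nat \<Rightarrow> 'a" where
  "const_point x = (\<lambda>m\<in>{1..M}. x)"

lemma measurable_const_point [measurable]: "const_point \<in> L \<rightarrow>\<^sub>M points \<Omega> M"
  unfolding const_point_def[abs_def] points_def by (rule measurable_restrict) simp

lemma const_point_in_space: "x \<in> \<Omega> \<Longrightarrow> const_point x \<in> space (points \<Omega> M)"
  by (auto simp: const_point_def space_points)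

lemma kernel_eq:
  assumes "z \<in> space (points \<Omega> M)" "J \<in> {1..N + 1}"
  shows "K z = distr (iteration \<Omega> \<kappa> p N M (z M) J) (points \<Omega> M) (accepted M)"
  using accepted assms by (simp add: accepted_samples_kernel_def)

lemma kernel_eq_const_point:
  assumes z: "z \<in> space (points \<Omega> M)"
  shows "K z = K (const_point (z M))"
proof -
  have "z M \<in> \<Omega>"
    using z M by (auto simp: space_points PiE_iff)
  then show ?thesis
    using kernel_eq[OF z, of 1] kernel_eq[OF const_point_in_space, of "z M" 1] M by (simp add: const_point_def)
qed

definition target_law :: "'a measure" where
  "target_law = density L (\<lambda>x. ennreal (\<pi> x))"

lemma sets_target_law [simp, measurable_cong]: "sets target_law = sets L"
  by (simp add: target_law_def)

lemma space_target_law [simp]: "space target_law = \<Omega>"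
  by (simp add: target_law_def)

lemma target_law_in_prob_algebra: "target_law \<in> space (prob_algebra L)"
proof -
  have "emeasure target_law (space L) = (\<integral>\<^sup>+x. ennreal (\<pi> x) * indicator (space L) x \<partial>L)"
    unfolding target_law_def by (intro emeasure_density sets.top) measurable
  also have "\<dots> = (\<integral>\<^sup>+x. ennreal (\<pi> x) \<partial>L)"
    by (intro nn_integral_cong) simp
  finally have "prob_space target_law"
    by (intro prob_spaceI) (simp add: \<pi>_integral)
  then show ?thesis
    by (simp add: space_prob_algebra)
qed

definition stationary_law :: "(nat \<Rightarrow> 'a) measure" where
  "stationary_law = Giry_Monad.bind target_law (\<lambda>x. K (const_point x))"

lemma measurable_kernel_const_point: "(\<lambda>x. K (const_point x)) \<in> L \<rightarrow>\<^sub>M prob_algebra (points \<Omega> M)"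
  by (rule measurable_compose[OF measurable_const_point kernel])

lemma stationary_law_in_prob_algebra: "stationary_law \<in> space (prob_algebra (points \<Omega> M))"
  using prob_space_bind'[OF target_law_in_prob_algebra measurable_kernel_const_point]
    sets_bind'[OF target_law_in_prob_algebra measurable_kernel_const_point]
  by (simp add: stationary_law_def space_prob_algebra)

text \<open>\<open>sum_nn_integral_selected\<close> gives the identity summed over the kept position
  \<open>J\<close>. Since \<open>K\<close> describes the accepted samples for every
  \<open>J\<close>, all \<open>N + 1\<close> summands on the left coincide, as those on the right
  do.\<close>

lemma nn_integral_stationary_law:
  assumes k: "k \<in> {1..M}" and \<phi> [measurable]: "\<phi> \<in> borel_measurable L"
  shows "(\<integral>\<^sup>+z. \<phi> (z k) \<partial>stationary_law) = (\<integral>\<^sup>+x. \<phi> x \<partial>target_law)"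
proof -
  let ?g = "\<lambda>x. \<integral>\<^sup>+z. \<phi> (z k) \<partial>K (const_point x)"
  have \<phi>k [measurable]: "(\<lambda>z. \<phi> (z k)) \<in> borel_measurable (points \<Omega> M)"
    by (rule measurable_compose[OF measurable_coordinate[OF k] \<phi>])
  have K_sub: "(\<lambda>x. K (const_point x)) \<in> L \<rightarrow>\<^sub>M subprob_algebra (points \<Omega> M)"
    by (rule measurable_prob_algebraD[OF measurable_kernel_const_point])
  have g [measurable]: "?g \<in> borel_measurable L"
    by (rule measurable_compose[OF K_sub nn_integral_measurable_subprob_algebra]) simp
  have "(\<integral>\<^sup>+z. \<phi> (z k) \<partial>stationary_law) = (\<integral>\<^sup>+x. ?g x \<partial>target_law)"
    unfolding stationary_law_def using K_sub by (intro nn_integral_bind[OF \<phi>k]) (simp add: measurable_cong_sets[OF sets_target_law refl])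
  also have "\<dots> = (\<integral>\<^sup>+x. ennreal (\<pi> x) * ?g x \<partial>L)"
    unfolding target_law_def by (rule nn_integral_density) measurable
  finally have lhs: "(\<integral>\<^sup>+z. \<phi> (z k) \<partial>stationary_law) = (\<integral>\<^sup>+x. ennreal (\<pi> x) * ?g x \<partial>L)" .
  have rhs: "(\<integral>\<^sup>+x. \<phi> x \<partial>target_law) = (\<integral>\<^sup>+x. ennreal (\<pi> x) * \<phi> x \<partial>L)"
    unfolding target_law_def by (rule nn_integral_density) measurable
  have step: "(\<integral>\<^sup>+x. ennreal (\<pi> x) * (\<integral>\<^sup>+(y, I). \<phi> (y (I k)) \<partial>iteration \<Omega> \<kappa> p N M x J) \<partial>L) = (\<integral>\<^sup>+x. ennreal (\<pi> x) * ?g x \<partial>L)"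
    if J: "J \<in> {1..N + 1}" for J
  proof (intro nn_integral_cong arg_cong2[where f = "(*)"] refl)
    fix x assume "x \<in> space L"
    then have x: "const_point x \<in> space (points \<Omega> M)" and cM: "const_point x M = x"
      using M by (auto simp: const_point_in_space) (simp add: const_point_def)
    have "?g x = (\<integral>\<^sup>+\<omega>. \<phi> (accepted M \<omega> k) \<partial>iteration \<Omega> \<kappa> p N M x J)"
      unfolding kernel_eq[OF x J] cM
      by (rule nn_integral_distr) (simp_all add: measurable_cong_sets[OF sets_iteration refl])
    also have "\<dots> = (\<integral>\<^sup>+(y, I). \<phi> (y (I k)) \<partial>iteration \<Omega> \<kappa> p N M x J)"
      using k by (intro nn_integral_cong) (auto simp: accepted_def)
    finally show "(\<integral>\<^sup>+(y, I). \<phi> (y (I k)) \<partial>iteration \<Omega> \<kappa> p N M x J) = ?g x" ..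
  qed
  have "(\<Sum>J=1..N + 1. \<integral>\<^sup>+x. ennreal (\<pi> x) * ?g x \<partial>L) = (\<Sum>J=1..N + 1. \<integral>\<^sup>+x. ennreal (\<pi> x) * \<phi> x \<partial>L)"
    unfolding sum_nn_integral_selected[OF k \<phi>, symmetric] by (intro sum.cong refl step[symmetric])
  \<comment> \<open>The factor \<open>N + 1\<close> is nonzero and finite, so it cancels in the
    extended reals.\<close>
  then have "of_nat (N + 1) * (\<integral>\<^sup>+x. ennreal (\<pi> x) * ?g x \<partial>L) = of_nat (N + 1) * (\<integral>\<^sup>+x. ennreal (\<pi> x) * \<phi> x \<partial>L)"
    by (simp only: sum_constant card_atLeastAtMost diff_Suc_1 Suc_eq_plus1 add_diff_cancel_right')
  then show ?thesis
    unfolding lhs rhs by (subst (asm) ennreal_mult_cancel_left) (auto simp: ennreal_of_nat_eq_real_of_nat)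
qed

lemma measurable_coordinate_stationary_law:
  assumes "k \<in> {1..M}"
  shows "(\<lambda>z. z k) \<in> stationary_law \<rightarrow>\<^sub>M L"
proof -
  have "sets stationary_law = sets (points \<Omega> M)"
    using stationary_law_in_prob_algebra by (simp add: space_prob_algebra)
  from measurable_cong_sets[OF this refl] measurable_coordinate[OF assms] show ?thesis
    by blast
qed

lemma distr_stationary_law:
  assumes k: "k \<in> {1..M}"
  shows "distr stationary_law L (\<lambda>z. z k) = target_law"
proof (rule measure_eqI)
  have m: "(\<lambda>z. z k) \<in> stationary_law \<rightarrow>\<^sub>M L"
    using k by (rule measurable_coordinate_stationary_law)
  show "sets (distr stationary_law L (\<lambda>z. z k)) = sets target_law"
    by simp
  fix A assume "A \<in> sets (distr stationary_law L (\<lambda>z. z k))"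
  then have A: "A \<in> sets L"
    by simp
  have "emeasure (distr stationary_law L (\<lambda>z. z k)) A = (\<integral>\<^sup>+x. indicator A x \<partial>distr stationary_law L (\<lambda>z. z k))"
    using A by simp
  also have "\<dots> = (\<integral>\<^sup>+z. indicator A (z k) \<partial>stationary_law)"
    using A by (intro nn_integral_distr[OF m]) simp
  also have "\<dots> = (\<integral>\<^sup>+x. indicator A x \<partial>target_law)"
    using A by (intro nn_integral_stationary_law[OF k]) simp
  also have "\<dots> = emeasure target_law A"
    using A by simp
  finally show "emeasure (distr stationary_law L (\<lambda>z. z k)) A = emeasure target_law A" .
qed

text \<open>\<open>K\<close> sees only the last coordinate, and that coordinate has the target law
  under \<open>stationary_law\<close>; one more transition therefore repeats the construction of
  \<open>stationary_law\<close>.\<close>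

lemma invariant_stationary_law: "invariant_probability (points \<Omega> M) K stationary_law"
  unfolding invariant_probability_def
proof (intro conjI ballI)
  show "prob_space stationary_law" and s [measurable_cong]: "sets stationary_law = sets (points \<Omega> M)"
    using stationary_law_in_prob_algebra by (simp_all add: space_prob_algebra)
  have M_mem: "M \<in> {1..M}"
    using M by simp
  have m: "(\<lambda>z. z M) \<in> stationary_law \<rightarrow>\<^sub>M L"
    using M_mem by (rule measurable_coordinate_stationary_law)
  fix A assume A: "A \<in> sets (points \<Omega> M)"
  have g: "(\<lambda>x. emeasure (K (const_point x)) A) \<in> borel_measurable L"
    by (rule measurable_compose[OF measurable_prob_algebraD[OF measurable_kernel_const_point] measurable_emeasure_subprob_algebra[OF A]])
  have "(\<integral>\<^sup>+z. emeasure (K z) A \<partial>stationary_law) = (\<integral>\<^sup>+z. emeasure (K (const_point (z M))) A \<partial>stationary_law)"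
    using sets_eq_imp_space_eq[OF s] by (intro nn_integral_cong arg_cong2[where f = emeasure] kernel_eq_const_point) auto
  also have "\<dots> = (\<integral>\<^sup>+x. emeasure (K (const_point x)) A \<partial>distr stationary_law L (\<lambda>z. z M))"
    using g by (intro nn_integral_distr[OF m, symmetric]) simp
  also have "\<dots> = (\<integral>\<^sup>+x. emeasure (K (const_point x)) A \<partial>target_law)"
    by (simp only: distr_stationary_law[OF M_mem])
  also have "\<dots> = emeasure stationary_law A"
    unfolding stationary_law_def
    by (rule emeasure_bind_prob_algebra[OF target_law_in_prob_algebra measurable_kernel_const_point A, symmetric])
  finally show "(\<integral>\<^sup>+z. emeasure (K z) A \<partial>stationary_law) = emeasure stationary_law A" .
qed

lemma integral_sample_average:
  fixes f :: "'a \<Rightarrow> real"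
  assumes f: "integrable target_law f"
  shows "integrable stationary_law (\<lambda>z. (\<Sum>m=1..M. f (z m)) / real M)"
    and "(\<integral>z. (\<Sum>m=1..M. f (z m)) / real M \<partial>stationary_law) = (\<integral>x. f x \<partial>target_law)"
proof -
  have f_meas: "f \<in> borel_measurable L"
    using borel_measurable_integrable[OF f] by (simp cong: measurable_cong_sets)
  have m: "(\<lambda>z. z k) \<in> stationary_law \<rightarrow>\<^sub>M L" if "k \<in> {1..M}" for k
    using that by (rule measurable_coordinate_stationary_law)
  have i: "integrable stationary_law (\<lambda>z. f (z k))" if "k \<in> {1..M}" for k
    by (rule integrable_distr[OF m[OF that]]) (simp only: distr_stationary_law[OF that] f)
  have e: "(\<integral>z. f (z k) \<partial>stationary_law) = (\<integral>x. f x \<partial>target_law)" if "k \<in> {1..M}" for k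
    using integral_distr[OF m[OF that] f_meas] by (simp only: distr_stationary_law[OF that])
  show "integrable stationary_law (\<lambda>z. (\<Sum>m=1..M. f (z m)) / real M)"
    by (intro integrable_divide Bochner_Integration.integrable_sum i)
  have "(\<integral>z. (\<Sum>m=1..M. f (z m)) / real M \<partial>stationary_law) = (\<Sum>m=1..M. \<integral>z. f (z m) \<partial>stationary_law) / real M"
    using i by (simp add: Bochner_Integration.integral_sum del: atLeastAtMost_iff)
  also have "\<dots> = (\<integral>x. f x \<partial>target_law)"
  proof -
    have "(\<Sum>m=1..M. \<integral>z. f (z m) \<partial>stationary_law) = (\<Sum>m=1..M. \<integral>x. f x \<partial>target_law)"
      by (intro sum.cong refl e)
    then show ?thesis
      using M by simp
  qed
  finally show "(\<integral>z. (\<Sum>m=1..M. f (z m)) / real M \<partial>stationary_law) = (\<integral>x. f x \<partial>target_law)" .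
qed

text \<open>The kernel of the outcome chain uses the selected point and its index, and
  \<open>accepted_samples_kernel\<close> says that the index no longer matters after projection to
  the accepted samples. This is the lumping condition of
  \<open>distr_chain_law_lumping\<close>.\<close>

lemma distr_accepted_samples:
  assumes mc: "mp_mcmc P \<Omega> \<kappa> p N M y\<^sub>1 Y I" and y: "y\<^sub>1 \<in> \<Omega>"
  shows "(\<lambda>\<omega> i. accepted M (Y (i + 1) \<omega>, I (i + 1) \<omega>)) \<in> P \<rightarrow>\<^sub>M Pi\<^sub>M UNIV (\<lambda>_. points \<Omega> M)"
    and "distr P (Pi\<^sub>M UNIV (\<lambda>_. points \<Omega> M)) (\<lambda>\<omega> i. accepted M (Y (i + 1) \<omega>, I (i + 1) \<omega>)) =
      chain_law (points \<Omega> M) (K (const_point y\<^sub>1)) K"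
proof -
  let ?O = "outcomes \<Omega> N M" and ?L = "\<lambda>(y, J). iteration \<Omega> \<kappa> p N M (y (J M)) (J M)"
  let ?X = "\<lambda>\<omega> i. (Y (i + 1) \<omega>, I (i + 1) \<omega>)" and ?\<nu> = "iteration \<Omega> \<kappa> p N M y\<^sub>1 1"
  have X: "(\<lambda>\<omega>. ?X \<omega> i) \<in> P \<rightarrow>\<^sub>M ?O" for i
    using mc by (simp add: mp_mcmc_def markov_chain_def)
  have law: "distr P (Pi\<^sub>M UNIV (\<lambda>_. ?O)) ?X = chain_law ?O ?\<nu> ?L"
    using mc by (simp add: mp_mcmc_def markov_chain_def)
  have X': "?X \<in> P \<rightarrow>\<^sub>M Pi\<^sub>M UNIV (\<lambda>_. ?O)"
    using X by (rule measurable_sequence)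
  have acc: "(\<lambda>\<omega> i. accepted M (\<omega> i)) \<in> Pi\<^sub>M UNIV (\<lambda>_. ?O) \<rightarrow>\<^sub>M Pi\<^sub>M UNIV (\<lambda>_. points \<Omega> M)"
    by measurable
  show "(\<lambda>\<omega> i. accepted M (?X \<omega> i)) \<in> P \<rightarrow>\<^sub>M Pi\<^sub>M UNIV (\<lambda>_. points \<Omega> M)"
    by (rule measurable_compose[OF X' acc])
  have \<nu>: "?\<nu> \<in> space (prob_algebra ?O)"
    using y by (simp add: space_prob_algebra prob_space_iteration)
  have lump: "distr (?L \<omega>) (points \<Omega> M) (accepted M) = K (accepted M \<omega>)" if \<omega>: "\<omega> \<in> space ?O" for \<omega>
  proof -
    obtain y J where yJ: "\<omega> = (y, J)"
      by (rule prod.exhaust)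
    have J: "J M \<in> {1..N + 1}"
      using \<omega> M by (auto simp: yJ outcomes_def space_pair_measure space_PiM PiE_iff)
    have "accepted M \<omega> \<in> space (points \<Omega> M)" "accepted M \<omega> M = y (J M)"
      using measurable_space[OF accepted_measurable \<omega>] M by (simp_all add: yJ accepted_def)
    with kernel_eq[of "accepted M \<omega>" "J M"] J show ?thesis
      by (simp add: yJ)
  qed
  have "distr P (Pi\<^sub>M UNIV (\<lambda>_. points \<Omega> M)) (\<lambda>\<omega> i. accepted M (?X \<omega> i)) =
    distr (distr P (Pi\<^sub>M UNIV (\<lambda>_. ?O)) ?X) (Pi\<^sub>M UNIV (\<lambda>_. points \<Omega> M)) (\<lambda>\<omega> i. accepted M (\<omega> i))"
    by (subst distr_distr[OF acc X']) (simp add: comp_def)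
  also have "\<dots> = chain_law (points \<Omega> M) (distr ?\<nu> (points \<Omega> M) (accepted M)) K"
    unfolding law
    by (rule distr_chain_law_lumping[OF markov_kernel_axioms _ \<nu> accepted_measurable lump])
       (rule markov_kernel.intro[OF measurable_step])
  \<comment> \<open>The first iteration keeps \<open>y\<^sub>1\<close> at index \<open>1\<close>,
    just as a transition out of a state with last coordinate \<open>y\<^sub>1\<close> may
    do.\<close>
  also have "distr ?\<nu> (points \<Omega> M) (accepted M) = K (const_point y\<^sub>1)"
    using kernel_eq[OF const_point_in_space[OF y], of 1] M by (simp add: const_point_def)
  finally show "distr P (Pi\<^sub>M UNIV (\<lambda>_. points \<Omega> M)) (\<lambda>\<omega> i. accepted M (?X \<omega> i)) =
    chain_law (points \<Omega> M) (K (const_point y\<^sub>1)) K" .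
qed

end

theorem lemma3p1:
  fixes \<Omega> :: "'a::euclidean_space set"
    and \<pi> f :: "'a \<Rightarrow> real"
    and \<kappa> :: "'a \<Rightarrow> (nat \<Rightarrow> 'a) \<Rightarrow> real"
    and p :: "(nat \<Rightarrow> 'a) \<Rightarrow> nat \<Rightarrow> real"
    and N M :: nat
    and P :: "'w measure"
    and y\<^sub>1 :: 'a
    and Y :: "nat \<Rightarrow> 'w \<Rightarrow> nat \<Rightarrow> 'a"
    and I :: "nat \<Rightarrow> 'w \<Rightarrow> nat \<Rightarrow> nat"
    and K :: "(nat \<Rightarrow> 'a) \<Rightarrow> (nat \<Rightarrow> 'a) measure"
  assumes "\<Omega> \<in> sets borel" and "1 \<le> N" and "1 \<le> M"
    and "is_target \<Omega> \<pi>"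
    and "is_proposal_kernel \<Omega> N \<kappa>"
    and "is_selection_probability \<Omega> \<pi> \<kappa> N p"
    and "y\<^sub>1 \<in> \<Omega>"
    and "mp_mcmc P \<Omega> \<kappa> p N M y\<^sub>1 Y I"
    and "accepted_samples_kernel \<Omega> \<kappa> p N M K"
    and "positive_harris (points \<Omega> M) K"
    and "f \<in> borel_measurable (restrict_space borel \<Omega>)"
    and "set_integrable lborel \<Omega> (\<lambda>x. f x * \<pi> x)"
  shows "AE \<omega> in P.
    (\<lambda>n. 1 / (real n * real M) * (\<Sum>i=1..n. \<Sum>m=1..M. f (accepted M (Y i \<omega>, I i \<omega>) m)))
      \<longlonglongrightarrow> (LINT x:\<Omega>|lborel. f x * \<pi> x)"
proof -
  interpret multiple_proposals_chain \<Omega> \<pi> \<kappa> N M p K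
    using assms by unfold_locales (auto simp: positive_harris_def)
  have f_meas [measurable]: "f \<in> borel_measurable L"
    using assms(11) by (simp cong: measurable_cong_sets add: sets_restrict_space)
  have \<Omega>_sets: "\<Omega> \<inter> space lborel \<in> sets lborel"
    using \<Omega> by simp
  have "integrable L (\<lambda>x. f x * \<pi> x)"
    using assms(12) unfolding set_integrable_def by (subst integrable_restrict_space[OF \<Omega>_sets]) simp
  then have f_int: "integrable target_law f"
    unfolding target_law_def
    by (subst integrable_density) (auto simp: \<pi>_nonneg mult.commute intro!: AE_I2)
  have f_lim: "(\<integral>x. f x \<partial>target_law) = (LINT x:\<Omega>|lborel. f x * \<pi> x)"
  proof -
    have "(\<integral>x. f x \<partial>target_law) = (\<integral>x. \<pi> x *\<^sub>R f x \<partial>L)"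
      unfolding target_law_def by (rule integral_density) (auto simp: \<pi>_nonneg intro!: AE_I2)
    also have "\<dots> = (LINT x:\<Omega>|lborel. f x * \<pi> x)"
      unfolding set_lebesgue_integral_def by (subst integral_restrict_space[OF \<Omega>_sets]) (simp add: mult.commute)
    finally show ?thesis .
  qed
  \<comment> \<open>Averaging within an iteration is a function on the state space of vectors, so
    the mean of all samples becomes a time average of \<open>?g\<close> along the chain.\<close>
  let ?g = "\<lambda>z. (\<Sum>m=1..M. f (z m)) / real M" and ?Z = "\<lambda>\<omega> i. accepted M (Y (i + 1) \<omega>, I (i + 1) \<omega>)"
  have "K (const_point y\<^sub>1) \<in> space (prob_algebra (points \<Omega> M))"
    by (intro kernel_in_prob_algebra const_point_in_space assms(7))
  from harris_law_of_large_numbers[OF _ invariant_stationary_law integral_sample_average(1)[OF f_int] this,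
      unfolded integral_sample_average(2)[OF f_int] f_lim]
  have "AE \<omega> in chain_law (points \<Omega> M) (K (const_point y\<^sub>1)) K.
      (\<lambda>n. (\<Sum>i<n. ?g (\<omega> i)) / real n) \<longlonglongrightarrow> (LINT x:\<Omega>|lborel. f x * \<pi> x)"
    using assms(10) unfolding positive_harris_def by blast
  then have "AE \<omega> in P. (\<lambda>n. (\<Sum>i<n. ?g (?Z \<omega> i)) / real n) \<longlonglongrightarrow> (LINT x:\<Omega>|lborel. f x * \<pi> x)"
    unfolding distr_accepted_samples(2)[OF assms(8,7), symmetric]
    by (rule AE_distrD[OF distr_accepted_samples(1)[OF assms(8,7)]])
  then show ?thesis
  proof eventually_elim
    case (elim \<omega>)
    \<comment> \<open>Iterations are counted from \<open>1\<close> and chain times from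
      \<open>0\<close>. For \<open>n = 0\<close> both sides are \<open>0\<close>.\<close>
    have "1 / (real n * real M) * (\<Sum>i=1..n. \<Sum>m=1..M. f (accepted M (Y i \<omega>, I i \<omega>) m)) = (\<Sum>i<n. ?g (?Z \<omega> i)) / real n" for n
    proof -
      have "(\<Sum>i=1..n. \<Sum>m=1..M. f (accepted M (Y i \<omega>, I i \<omega>) m)) = (\<Sum>i<n. \<Sum>m=1..M. f (?Z \<omega> i m))"
        by (rule sum.reindex_bij_witness[of _ "\<lambda>i. i + 1" "\<lambda>i. i - 1"]) auto
      then show ?thesis
        by (simp add: sum_divide_distrib[symmetric] mult.commute)
    qed
    with elim show ?case
      by (simp only:)
  qed
qed

end
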